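(* Let $n,k$ be positive integers with $k<n$, let $\delta$ be a nonnegative integer, and let $p$ be a prime number. Then there exists a (sufficiently large) finite field $\mathbb{F}$ of characteristic $p$ and an $(n,k,\delta)$-code over $\mathbb{F}$ that is both a maximum distance profile (MDP) code and a strongly MDS (sMDS) code.
   Context: Let $\mathbb{F}$ be a finite field and $k<n$ positive integers. A convolutional code $\mathcal{C}$ of rate $k/n$ over $\mathbb{F}$ is a rank-$k$ direct summand of the free $\mathbb{F}[s]$-module $\mathbb{F}[s]^n$. A generator matrix of $\mathcal{C}$ is a full-rank matrix $G(s)\in\mathbb{F}[s]^{n\times k}$ whose column space (the $\mathbb{F}[s]$-span of its columns) is $\mathcal{C}$. The degree of $\mathcal{C}$ is the maximal degree of the determinant of a $k\times k$ submatrix of a generator matrix of $\mathcal{C}$ (independent of the generator matrix). An $(n,k,\delta)$-code is a convolutional code of rate $k/n$ and degree $\delta$. Identify $\mathbb{F}[s]^n$ with $\mathbb{F}^n[s]$, so that a codeword is written $v(s)=\sum_{t=0}^{d} v_t s^t$ with $v_t\in\mathbb{F}^n$, and put $v_t=0$ for $t>\deg v(s)$. For $v\in\mathbb{F}^n$, $\mathrm{wt}(v)$ is the number of nonzero components of $v$. For $j\ge 0$ the $j$th column distance of $\mathcal{C}$ is $$d_j^c(\mathcal{C})=\min\Big\{\sum_{t=0}^{j}\mathrm{wt}(v_t)\ :\ v(s)\in\mathcal{C},\ v_0\neq 0\Big\}.$$ Set $L=\lfloor \delta/k\rfloor+\lfloor\delta/(n-k)\rfloor$ and $M=\lfloor \delta/k\rfloor+\lceil\delta/(n-k)\rceil$.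 An $(n,k,\delta)$-code $\mathcal{C}$ is MDP if $d_L^c(\mathcal{C})=(n-k)(L+1)+1$, and it is sMDS if $d_M^c(\mathcal{C})=(n-k)\left(\lfloor\delta/k\rfloor+1\right)+\delta+1$. *)

theory Defs
  imports
    "HOL-Computational_Algebra.Primes"
    "HOL-Algebra.UnivPoly"
    "HOL-Algebra.Multiplicative_Group"
    "Jordan_Normal_Form.Missing_VectorSpace"
    "Jordan_Normal_Form.DL_Submatrix"
begin

text \<open>
  Finite fields are HOL-Algebra structures, so that the field itself can be quantified over
  existentially.  The polynomial ring over \<open>F\<close> is \<open>UP F\<close>; vectors and matrices use the container
  types of Jordan_Normal_Form, without its type-class based arithmetic.
\<close>

definition ring_characteristic :: "('a, 'b) ring_scheme \<Rightarrow> nat" where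
  "ring_characteristic R = group.ord (add_monoid R) \<one>\<^bsub>R\<^esub>"

text \<open>The free module of rank \<open>n\<close>.  A module record extends a ring record; the two multiplicative
  fields play no role.\<close>

definition free_module :: "('a, 'b) ring_scheme \<Rightarrow> nat \<Rightarrow> ('a, 'a vec) module" where
  "free_module R n = \<lparr>
     carrier = {v \<in> carrier_vec n. \<forall>i<n. v $ i \<in> carrier R},
     mult = undefined,
     one = undefined,
     zero = vec n (\<lambda>_. \<zero>\<^bsub>R\<^esub>),
     add = (\<lambda>u v. vec n (\<lambda>i. u $ i \<oplus>\<^bsub>R\<^esub> v $ i)),
     smult = (\<lambda>c v. vec n (\<lambda>i. c \<otimes>\<^bsub>R\<^esub> v $ i))\<rparr>"

lemma free_module_is_module:
  assumes "cring R"
  shows "module R (free_module R n)"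
proof -
  interpret R: cring R by fact
  have "\<exists>y\<in>carrier (free_module R n). y \<oplus>\<^bsub>free_module R n\<^esub> x = \<zero>\<^bsub>free_module R n\<^esub>"
    if "x \<in> carrier (free_module R n)" for x
    using that
    by (intro bexI[of _ "vec n (\<lambda>i. \<ominus>\<^bsub>R\<^esub> x $ i)"]) (auto simp: free_module_def R.l_neg)
  then have "abelian_group (free_module R n)"
    by (intro abelian_groupI)
      (auto simp: free_module_def R.a_ac intro!: eq_vecI)
  then show ?thesis
    by (intro moduleI assms)
      (auto simp: free_module_def R.l_distr R.r_distr R.m_assoc intro!: eq_vecI)
qed

definition direct_summand ::
    "'m set \<Rightarrow> ('a, 'b) ring_scheme \<Rightarrow> ('a, 'm, 'c) module_scheme \<Rightarrow> bool" where
  "direct_summand C R M \<longleftrightarrow> submodule R C M \<and>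
     (\<exists>D. submodule R D M \<and> C \<inter> D = {\<zero>\<^bsub>M\<^esub>} \<and> C <+>\<^bsub>M\<^esub> D = carrier M)"

text \<open>Rank is understood as the size of a basis: a direct summand of a finitely generated free
  module over the principal ideal domain \<open>UP F\<close> is free.\<close>

definition free_of_rank ::
    "'m set \<Rightarrow> ('a, 'b) ring_scheme \<Rightarrow> ('a, 'm, 'c) module_scheme \<Rightarrow> nat \<Rightarrow> bool" where
  "free_of_rank C R M k \<longleftrightarrow>
     (\<exists>B. B \<subseteq> C \<and> finite B \<and> card B = k \<and> \<not> module.lin_dep R M B \<and> module.span R M B = C)"

definition convolutional_code ::
    "('a, 'b) ring_scheme \<Rightarrow> nat \<Rightarrow> nat \<Rightarrow> (nat \<Rightarrow> 'a) vec set \<Rightarrow> bool" where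
  "convolutional_code F n k C \<longleftrightarrow>
     direct_summand C (UP F) (free_module (UP F) n) \<and>
     free_of_rank C (UP F) (free_module (UP F) n) k"

text \<open>Full rank of an \<open>n \<times> k\<close> matrix with \<open>k \<le> n\<close>: its \<open>k\<close> columns are linearly independent.
  Linear independence is a predicate on sets, hence the separate distinctness condition.\<close>

definition generator_matrix ::
    "('a, 'b) ring_scheme \<Rightarrow> nat \<Rightarrow> nat \<Rightarrow> (nat \<Rightarrow> 'a) vec set \<Rightarrow> (nat \<Rightarrow> 'a) mat \<Rightarrow> bool" where
  "generator_matrix F n k C G \<longleftrightarrow>
     G \<in> carrier_mat n k \<and>
     set (cols G) \<subseteq> carrier (free_module (UP F) n) \<and>
     distinct (cols G) \<and>
     \<not> module.lin_dep (UP F) (free_module (UP F) n) (set (cols G)) \<and>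
     module.span (UP F) (free_module (UP F) n) (set (cols G)) = C"

definition ring_det :: "('a, 'b) ring_scheme \<Rightarrow> 'a mat \<Rightarrow> 'a" where
  "ring_det R A =
     (\<Oplus>\<^bsub>R\<^esub>\<sigma> \<in> {\<sigma>. \<sigma> permutes {0..<dim_row A}}.
        add_pow R (sign \<sigma> :: int) (\<Otimes>\<^bsub>R\<^esub>i \<in> {0..<dim_row A}. A $$ (i, \<sigma> i)))"

text \<open>The inner maximum over the \<open>k \<times> k\<close> minors does not depend on the generator matrix, so the set
  below is finite.  Vanishing minors contribute \<open>deg F \<zero> = 0\<close>, which is harmless because some
  minor of a generator matrix is nonzero.\<close>

definition code_degree ::
    "('a, 'b) ring_scheme \<Rightarrow> nat \<Rightarrow> nat \<Rightarrow> (nat \<Rightarrow> 'a) vec set \<Rightarrow> nat" where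
  "code_degree F n k C =
     Max {deg F (ring_det (UP F) (submatrix G I UNIV)) | G I.
            generator_matrix F n k C G \<and> I \<subseteq> {..<n} \<and> card I = k}"

definition nkd_code ::
    "('a, 'b) ring_scheme \<Rightarrow> nat \<Rightarrow> nat \<Rightarrow> nat \<Rightarrow> (nat \<Rightarrow> 'a) vec set \<Rightarrow> bool" where
  "nkd_code F n k \<delta> C \<longleftrightarrow> convolutional_code F n k C \<and> code_degree F n k C = \<delta>"

text \<open>\<open>vec_coeff F v t\<close> is the coefficient vector \<open>v\<^sub>t\<close> under the identification of
  \<open>F[s]\<^sup>n\<close> with \<open>F\<^sup>n[s]\<close>.\<close>

definition vec_coeff :: "('a, 'b) ring_scheme \<Rightarrow> (nat \<Rightarrow> 'a) vec \<Rightarrow> nat \<Rightarrow> 'a vec" where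
  "vec_coeff F v t = map_vec (\<lambda>q. up_ring.coeff (UP F) q t) v"

definition weight :: "('a, 'b) ring_scheme \<Rightarrow> 'a vec \<Rightarrow> nat" where
  "weight F v = card {i. i < dim_vec v \<and> v $ i \<noteq> \<zero>\<^bsub>F\<^esub>}"

text \<open>\<open>Inf\<close> of a nonempty set of natural numbers is its minimum.\<close>

definition column_distance ::
    "('a, 'b) ring_scheme \<Rightarrow> nat \<Rightarrow> (nat \<Rightarrow> 'a) vec set \<Rightarrow> nat \<Rightarrow> nat" where
  "column_distance F n C j =
     Inf {\<Sum>t = 0..j. weight F (vec_coeff F v t) | v.
            v \<in> C \<and> vec_coeff F v 0 \<noteq> \<zero>\<^bsub>free_module F n\<^esub>}"

definition MDP_index :: "nat \<Rightarrow> nat \<Rightarrow> nat \<Rightarrow> nat" where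
  "MDP_index n k \<delta> = \<delta> div k + \<delta> div (n - k)"

definition sMDS_index :: "nat \<Rightarrow> nat \<Rightarrow> nat \<Rightarrow> nat" where
  "sMDS_index n k \<delta> = \<delta> div k + nat \<lceil>real \<delta> / real (n - k)\<rceil>"

definition MDP_code ::
    "('a, 'b) ring_scheme \<Rightarrow> nat \<Rightarrow> nat \<Rightarrow> nat \<Rightarrow> (nat \<Rightarrow> 'a) vec set \<Rightarrow> bool" where
  "MDP_code F n k \<delta> C \<longleftrightarrow> nkd_code F n k \<delta> C \<and>
     column_distance F n C (MDP_index n k \<delta>) = (n - k) * (MDP_index n k \<delta> + 1) + 1"

definition sMDS_code ::
    "('a, 'b) ring_scheme \<Rightarrow> nat \<Rightarrow> nat \<Rightarrow> nat \<Rightarrow> (nat \<Rightarrow> 'a) vec set \<Rightarrow> bool" where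
  "sMDS_code F n k \<delta> C \<longleftrightarrow> nkd_code F n k \<delta> C \<and>
     column_distance F n C (sMDS_index n k \<delta>) = (n - k) * (\<delta> div k + 1) + \<delta> + 1"

end

theory Submission
  imports Defs "Jordan_Normal_Form.Determinant" "HOL-Computational_Algebra.Polynomial_Factorial"
begin

text \<open>
  The code is explicit.  Put \<open>a = \<delta> div k\<close> and \<open>b = \<delta> mod k\<close>, give the first \<open>k - b\<close> columns degree \<open>a\<close>
  and the last \<open>b\<close> columns degree \<open>a + 1\<close>, so that the column degrees add up to \<open>\<delta>\<close>, and let the
  entry of the generator matrix at \<open>(i, j)\<close> be the sum of the \<open>X\<^bsup>(n d + i - j)\<^sup>2\<^esup> s\<^sup>d\<close> for \<open>d\<close> up to the degree
  of column \<open>j\<close>.  Here \<open>X\<close> is first an indeterminate over the integers and in the end an element of a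
  finite field.

  Every condition on the code is the nonvanishing of minors of sliding block matrices that are built
  from these coefficients.  The rows of such a matrix have integer weights \<open>\<rho>\<close> and its columns have
  integer weights \<open>\<kappa>\<close>, and each nonzero entry is \<open>X\<^bsup>(\<rho> - \<kappa>)\<^sup>2\<^esup>\<close>.  Expanding the squares shows that the
  exponent of a term of the Leibniz formula is smallest where the sum of the products \<open>\<rho> \<kappa>\<close> along the
  permutation is largest; by the strict rearrangement inequality this happens only if rows and columns are
  matched in the order of their weights.  So the determinant has a coefficient \<open>\<plusminus>1\<close> as soon as this one
  matching avoids the zero entries, whatever the pattern of the other zeros
  (\<open>det_square_distance_powers\<close>), and then it does not vanish modulo any prime.  For finitely many such
  polynomials there is a finite field of characteristic \<open>p\<close>, a quotient of \<open>\<int>[X]\<close>, in which none of them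
  becomes zero (\<open>finite_field_avoiding_roots\<close>).

  Three kinds of minors are needed.  A square matrix that lists the coefficients of products of powers of \<open>s\<close>
  with rows of the generator matrix is invertible, so the rows of the generator matrix span the whole
  free module; the generator matrix then has a polynomial left inverse, so that the code is a direct summand
  (\<open>gen_mat_left_inverse\<close>).  The matrix of the leading coefficients in the first \<open>k\<close> rows is invertible, so that the degree is \<open>\<delta>\<close>
  (\<open>coeff_leading_minor\<close>).  For the distances, consider a codeword with nonzero initial vector
  and its zeros among the first \<open>J + 1\<close> coefficient vectors.  If there are too many of them, then a
  counting argument selects \<open>k (J' + 1)\<close> zeros in a possibly shorter window at which the ordered
  matching meets only nonzero entries (\<open>select_rows\<close>); then the message vanishes on this window,
  which is absurd.  The cases \<open>J = L\<close> and \<open>J = M\<close> are the lower bounds for the MDP and for the sMDS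
  property (\<open>weight_lower_bound\<close>).  The upper bounds come from messages that produce prescribed zeros
  (\<open>message_with_prescribed_zeros\<close>).

  All matrix algebra takes place over the commutative rings \<open>\<int>[X]\<close> and \<open>\<int>[X][s]\<close>, where
  determinants and adjugates are available, and is transported along the surjections onto the finite
  field \<open>F\<close> and onto \<open>F[s]\<close>.
\<close>

section \<open>Determinants of powers with squared differences as exponents\<close>

lemma permutes_mono_imp_id:
  fixes \<sigma> :: "nat \<Rightarrow> nat"
  assumes \<sigma>: "\<sigma> permutes {0..<m}"
    and mono: "\<And>i j. i < j \<Longrightarrow> j < m \<Longrightarrow> \<sigma> i \<le> \<sigma> j"
  shows "\<sigma> = id"
proof -
  have less: "\<sigma> i < m" if "i < m" for i
    using permutes_in_image[OF \<sigma>, of i] that by simp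
  have smono: "\<sigma> i < \<sigma> j" if "i < j" "j < m" for i j
    using mono[OF that] permutes_inj[OF \<sigma>, unfolded inj_def] that by (metis le_neq_implies_less nat_neq_iff)
  have ge: "i \<le> \<sigma> i" if "i < m" for i
    using that
  proof (induction i)
    case (Suc i)
    then show ?case using smono[of i "Suc i"] by simp
  qed simp
  have up: "\<sigma> (m - Suc i) \<le> m - Suc i" if "i < m" for i
    using that
  proof (induction i)
    case 0
    then show ?case using less[of "m - 1"] by simp
  next
    case (Suc i)
    then have "m - Suc (Suc i) < m - Suc i" "m - Suc i < m" by simp_all
    with Suc smono[of "m - Suc (Suc i)" "m - Suc i"] show ?case by linarith
  qed
  show ?thesis
  proof
    fix i show "\<sigma> i = id i"
    proof (cases "i < m")
      case True
      with ge[of i] up[of "m - Suc i"] show ?thesis by simp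
    next
      case False
      then show ?thesis using permutes_not_in[OF \<sigma>, of i] by simp
    qed
  qed
qed

text \<open>If a permutation has an inversion, undoing it increases the sum.  A permutation with the largest sum
therefore has no inversion and is the identity; any other permutation is beaten by one of its swaps,
hence by the identity.\<close>

lemma rearrangement_strict:
  fixes \<rho> \<kappa> :: "nat \<Rightarrow> int"
  assumes \<rho>: "strict_mono_on {0..<m} \<rho>" and \<kappa>: "strict_mono_on {0..<m} \<kappa>"
    and \<sigma>: "\<sigma> permutes {0..<m}" and "\<sigma> \<noteq> id"
  shows "(\<Sum>i\<in>{0..<m}. \<rho> i * \<kappa> (\<sigma> i)) < (\<Sum>i\<in>{0..<m}. \<rho> i * \<kappa> i)"
proof -
  define f where "f \<sigma> = (\<Sum>i\<in>{0..<m}. \<rho> i * \<kappa> (\<sigma> i))" for \<sigma>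
  have swap: "\<exists>\<tau>. \<tau> permutes {0..<m} \<and> f \<sigma> < f \<tau>" if \<sigma>: "\<sigma> permutes {0..<m}" "\<sigma> \<noteq> id" for \<sigma>
  proof -
    obtain i j where ij: "i < j" "j < m" "\<sigma> j < \<sigma> i"
      using permutes_mono_imp_id[OF \<sigma>(1)] \<sigma>(2) by (meson not_le)
    define \<tau> where "\<tau> = \<sigma> \<circ> transpose i j"
    have \<tau>: "\<tau> permutes {0..<m}"
      unfolding \<tau>_def using ij by (intro permutes_compose permutes_swap_id \<sigma>) auto
    have lt: "\<rho> i < \<rho> j" using strict_mono_onD[OF \<rho>, of i j] ij by simp
    have "\<sigma> i < m" "\<sigma> j < m" using permutes_in_image[OF \<sigma>(1)] ij by auto
    then have lt': "\<kappa> (\<sigma> j) < \<kappa> (\<sigma> i)" using strict_mono_onD[OF \<kappa>, of "\<sigma> j" "\<sigma> i"] ij by simp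
    \<comment> \<open>Only the two swapped terms change.\<close>
    have split: "f \<tau> = \<rho> i * \<kappa> (\<tau> i) + (\<rho> j * \<kappa> (\<tau> j) + (\<Sum>l\<in>{0..<m} - {i} - {j}. \<rho> l * \<kappa> (\<tau> l)))" for \<tau>
      unfolding f_def using ij by (subst sum.remove[of _ i], simp, simp, subst sum.remove[of _ j]) auto
    have "(\<Sum>l\<in>{0..<m} - {i} - {j}. \<rho> l * \<kappa> (\<tau> l)) = (\<Sum>l\<in>{0..<m} - {i} - {j}. \<rho> l * \<kappa> (\<sigma> l))"
      by (intro sum.cong) (auto simp: \<tau>_def transpose_def)
    moreover have "\<tau> i = \<sigma> j" "\<tau> j = \<sigma> i" by (auto simp: \<tau>_def)
    ultimately have "f \<tau> - f \<sigma> = (\<rho> j - \<rho> i) * (\<kappa> (\<sigma> i) - \<kappa> (\<sigma> j))"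
      unfolding split by (simp add: algebra_simps)
    also have "\<dots> > 0" using lt lt' by simp
    finally show ?thesis using \<tau> by auto
  qed
  let ?P = "{\<sigma>. \<sigma> permutes {0..<m}}"
  have fin: "finite (f ` ?P)" by (simp add: finite_permutations)
  have ne: "f ` ?P \<noteq> {}" using permutes_id by blast
  obtain \<mu> where \<mu>: "\<mu> permutes {0..<m}" "f \<mu> = Max (f ` ?P)" using Max_in[OF fin ne] by auto
  have max: "f \<tau> \<le> f \<mu>" if "\<tau> permutes {0..<m}" for \<tau>
    unfolding \<mu>(2) using that by (intro Max_ge fin) auto
  have "\<mu> = id" using swap[OF \<mu>(1)] max by (meson not_le)
  moreover obtain \<tau> where "\<tau> permutes {0..<m}" "f \<sigma> < f \<tau>" using swap assms by blast
  ultimately show ?thesis using max[of \<tau>] by (auto simp: f_def)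
qed

text \<open>The sum of \<open>(\<rho> i - \<kappa> (\<sigma> i))\<^sup>2\<close> differs from minus twice the sum of \<open>\<rho> i * \<kappa> (\<sigma> i)\<close> by a quantity that does not
depend on \<open>\<sigma>\<close>.  By the rearrangement inequality \<open>\<pi>\<close> is the only permutation with the least exponent, so
its term \<open>\<plusminus>1\<close> cannot be cancelled.  Zero entries only remove terms from the Leibniz formula, and
the hypothesis on \<open>S\<close> keeps the term of \<open>\<pi>\<close>.\<close>

lemma det_square_distance_powers:
  fixes A :: "int poly mat" and \<rho> \<kappa> :: "nat \<Rightarrow> int"
  assumes A: "A \<in> carrier_mat m m"
    and entry: "\<And>i j. i < m \<Longrightarrow> j < m \<Longrightarrow>
      A $$ (i, j) = (if S i j then Polynomial.monom 1 (nat ((\<rho> i - \<kappa> j)\<^sup>2)) else 0)"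
    and \<rho>: "strict_mono_on {0..<m} \<rho>"
    and \<pi>: "\<pi> permutes {0..<m}" and \<kappa>: "strict_mono_on {0..<m} (\<kappa> \<circ> \<pi>)"
    and diag: "\<And>i. i < m \<Longrightarrow> S i (\<pi> i)"
  shows "\<exists>e. \<bar>Polynomial.coeff (det A) e\<bar> = 1"
proof -
  define ex where "ex \<sigma> = (\<Sum>i\<in>{0..<m}. nat ((\<rho> i - \<kappa> (\<sigma> i))\<^sup>2))" for \<sigma>
  have less: "\<sigma> i < m" if "i < m" "\<sigma> permutes {0..<m}" for \<sigma> i
    using permutes_in_image[OF that(2), of i] that by simp
  have prod: "(\<Prod>i\<in>{0..<m}. A $$ (i, \<sigma> i)) =
      (if \<forall>i<m. S i (\<sigma> i) then Polynomial.monom 1 (ex \<sigma>) else 0)" if \<sigma>: "\<sigma> permutes {0..<m}" for \<sigma>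
  proof (cases "\<forall>i<m. S i (\<sigma> i)")
    case True
    have monprod: "(\<Prod>i\<in>I. Polynomial.monom (1::int) (g i)) = Polynomial.monom 1 (sum g I)" if "finite I" for g and I :: "nat set"
      using that by induction (auto simp: Polynomial.mult_monom simp flip: Polynomial.one_poly_eq_simps(1) monom_0)
    have "(\<Prod>i\<in>{0..<m}. A $$ (i, \<sigma> i)) = (\<Prod>i\<in>{0..<m}. Polynomial.monom 1 (nat ((\<rho> i - \<kappa> (\<sigma> i))\<^sup>2)))"
      using True less[OF _ \<sigma>] by (intro prod.cong) (auto simp: entry)
    also have "\<dots> = Polynomial.monom 1 (\<Sum>i\<in>{0..<m}. nat ((\<rho> i - \<kappa> (\<sigma> i))\<^sup>2))"
      by (rule monprod) simp
    also have "(\<Sum>i\<in>{0..<m}. nat ((\<rho> i - \<kappa> (\<sigma> i))\<^sup>2)) = ex \<sigma>"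
      unfolding ex_def ..
    finally show ?thesis using True by simp
  next
    case False
    then obtain i where "i < m" "\<not> S i (\<sigma> i)" by auto
    then have "A $$ (i, \<sigma> i) = 0" using less[OF _ \<sigma>] by (simp add: entry)
    then have "(\<Prod>i\<in>{0..<m}. A $$ (i, \<sigma> i)) = 0" using \<open>i < m\<close> by (intro prod_zero) auto
    then show ?thesis using False by auto
  qed
  \<comment> \<open>Composing with the inverse of \<open>\<pi>\<close> reduces to the case that \<open>\<kappa>\<close> is increasing and \<open>\<pi>\<close> is the identity.\<close>
  have exless: "ex \<pi> < ex \<sigma>" if \<sigma>: "\<sigma> permutes {0..<m}" "\<sigma> \<noteq> \<pi>" for \<sigma>
  proof -
    define \<tau> where "\<tau> = inv_into UNIV \<pi> \<circ> \<sigma>"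
    have \<tau>: "\<tau> permutes {0..<m}" unfolding \<tau>_def using \<sigma>(1) \<pi> by (intro permutes_compose permutes_inv)
    have \<pi>\<tau>: "\<pi> (\<tau> i) = \<sigma> i" for i unfolding \<tau>_def using permutes_inverses[OF \<pi>] by simp
    have "\<tau> \<noteq> id" using \<pi>\<tau> \<sigma>(2) by (metis eq_id_iff ext)
    from rearrangement_strict[OF \<rho> \<kappa> \<tau> this]
    have lt: "(\<Sum>i\<in>{0..<m}. \<rho> i * \<kappa> (\<sigma> i)) < (\<Sum>i\<in>{0..<m}. \<rho> i * \<kappa> (\<pi> i))"
      by (simp add: \<pi>\<tau>)
    have sq: "(\<Sum>i\<in>{0..<m}. (\<rho> i - \<kappa> (\<sigma> i))\<^sup>2) =
        (\<Sum>i\<in>{0..<m}. (\<rho> i)\<^sup>2) + (\<Sum>i\<in>{0..<m}. (\<kappa> i)\<^sup>2) - 2 * (\<Sum>i\<in>{0..<m}. \<rho> i * \<kappa> (\<sigma> i))"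
      if \<sigma>: "\<sigma> permutes {0..<m}" for \<sigma>
    proof -
      have "(\<Sum>i\<in>{0..<m}. (\<kappa> i)\<^sup>2) = (\<Sum>i\<in>{0..<m}. (\<kappa> (\<sigma> i))\<^sup>2)"
        using sum.permute[OF \<sigma>, of "\<lambda>i. (\<kappa> i)\<^sup>2"] by (simp add: o_def)
      then show ?thesis
        by (simp add: power2_diff sum.distrib sum_subtractf sum_distrib_left algebra_simps)
    qed
    have "(\<Sum>i\<in>{0..<m}. (\<rho> i - \<kappa> (\<pi> i))\<^sup>2) < (\<Sum>i\<in>{0..<m}. (\<rho> i - \<kappa> (\<sigma> i))\<^sup>2)"
      using lt sq[OF \<sigma>(1)] sq[OF \<pi>] by simp
    then have "int (ex \<pi>) < int (ex \<sigma>)" unfolding ex_def by simp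
    then show ?thesis by simp
  qed
  have "Polynomial.coeff (det A) (ex \<pi>) =
      (\<Sum>\<sigma>\<in>{\<sigma>. \<sigma> permutes {0..<m}}. Polynomial.coeff (signof \<sigma> * (\<Prod>i\<in>{0..<m}. A $$ (i, \<sigma> i))) (ex \<pi>))"
    unfolding det_def'[OF A] by (simp add: Polynomial.coeff_sum)
  also have "\<dots> = (\<Sum>\<sigma>\<in>{\<sigma>. \<sigma> permutes {0..<m}}. if \<sigma> = \<pi> then sign \<pi> else 0)"
  proof (intro sum.cong refl)
    fix \<sigma> assume "\<sigma> \<in> {\<sigma>. \<sigma> permutes {0..<m}}"
    then have \<sigma>: "\<sigma> permutes {0..<m}" by simp
    show "Polynomial.coeff (signof \<sigma> * (\<Prod>i\<in>{0..<m}. A $$ (i, \<sigma> i))) (ex \<pi>) = (if \<sigma> = \<pi> then sign \<pi> else 0)"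
    proof (cases "\<sigma> = \<pi>")
      case True
      then show ?thesis using diag by (auto simp: prod[OF \<pi>] sign_def)
    next
      case False
      with exless[OF \<sigma>] have "ex \<sigma> \<noteq> ex \<pi>" by simp
      with False show ?thesis by (auto simp: prod[OF \<sigma>] sign_def)
    qed
  qed
  also have "\<dots> = sign \<pi>" using \<pi> by (simp add: finite_permutations)
  finally show ?thesis by (intro exI[of _ "ex \<pi>"]) (simp add: sign_def)
qed

section \<open>Finite fields as quotients of the integer polynomials\<close>

text \<open>A bridge between type classes and structures: the elements of the structure \<open>R\<close> are represented by
those of a type, where the library has determinants, adjugates and polynomials.  Identities are proved
upstairs and then mapped to \<open>R\<close>.\<close>

locale onto_ring_hom = cring R for R (structure) +
  fixes h :: "'c::comm_ring_1 \<Rightarrow> 'a"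
  assumes carrier_eq: "carrier R = range h"
    and h_add: "h (x + y) = h x \<oplus> h y"
    and h_mult: "h (x * y) = h x \<otimes> h y"
    and h_one: "h 1 = \<one>"
begin

lemma h_closed [simp, intro]: "h x \<in> carrier R"
  by (simp add: carrier_eq)

lemma h_zero: "h 0 = \<zero>"
  using h_add[of 0 0] by (metis add.l_cancel_one h_closed add_0)

lemma h_uminus: "h (- x) = \<ominus> h x"
  using h_add[of "- x" x] by (simp add: h_zero minus_equality)

lemma h_diff_zero_iff: "h (x - y) = \<zero> \<longleftrightarrow> h x = h y"
  using h_add[of x "- y"] h_uminus[of y] by (simp add: r_right_minus_eq[unfolded a_minus_def])

lemma h_of_nat: "h (of_nat n) = [n] \<cdot> \<one>"
  by (induction n) (simp_all add: h_zero h_add h_one a_comm)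

lemma h_sum: "h (sum f A) = (\<Oplus>i\<in>A. h (f i))"
  by (induction A rule: infinite_finite_induct) (simp_all add: h_zero h_add finsum_infinite)

lemma h_prod: "h (prod f A) = (\<Otimes>i\<in>A. h (f i))"
  by (induction A rule: infinite_finite_induct) (simp_all add: h_one h_mult finprod_infinite)

end

definition ring_ideal :: "'a::comm_ring_1 set \<Rightarrow> bool" where
  "ring_ideal I \<longleftrightarrow> 0 \<in> I \<and> (\<forall>x\<in>I. \<forall>y\<in>I. x + y \<in> I) \<and> (\<forall>r. \<forall>x\<in>I. r * x \<in> I)"

lemma ring_idealD:
  assumes "ring_ideal I"
  shows "0 \<in> I" "x \<in> I \<Longrightarrow> y \<in> I \<Longrightarrow> x + y \<in> I" "x \<in> I \<Longrightarrow> r * x \<in> I"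
    "x \<in> I \<Longrightarrow> x * r \<in> I" "x \<in> I \<Longrightarrow> - x \<in> I" "x \<in> I \<Longrightarrow> y \<in> I \<Longrightarrow> x - y \<in> I"
proof -
  show 1: "0 \<in> I" "x \<in> I \<Longrightarrow> y \<in> I \<Longrightarrow> x + y \<in> I" "\<And>r x. x \<in> I \<Longrightarrow> r * x \<in> I" for x y
    using assms by (auto simp: ring_ideal_def)
  show "x \<in> I \<Longrightarrow> x * r \<in> I" using 1(3)[of x r] by (simp add: mult.commute)
  show 2: "x \<in> I \<Longrightarrow> - x \<in> I" for x using 1(3)[of x "-1"] by simp
  show "x \<in> I \<Longrightarrow> y \<in> I \<Longrightarrow> x - y \<in> I" using 1(2)[of x "-y"] 2[of y] by simp
qed

text \<open>Zorn's lemma, with maximality stated in the form in which it makes the quotient a field.\<close>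

lemma maximal_ideal_exists:
  fixes J :: "'a::comm_ring_1 set"
  assumes "ring_ideal J" "1 \<notin> J"
  shows "\<exists>M. ring_ideal M \<and> J \<subseteq> M \<and> 1 \<notin> M \<and> (\<forall>x. x \<notin> M \<longrightarrow> (\<exists>y. x * y - 1 \<in> M))"
proof -
  let ?A = "{I. ring_ideal I \<and> J \<subseteq> I \<and> 1 \<notin> I}"
  have "\<exists>M\<in>?A. \<forall>X\<in>?A. M \<subseteq> X \<longrightarrow> X = M"
  proof (rule subset_Zorn_nonempty)
    show "?A \<noteq> {}" using assms by auto
    fix \<C> assume ne: "\<C> \<noteq> {}" and ch: "subset.chain ?A \<C>"
    then have sub: "I \<in> ?A" if "I \<in> \<C>" for I using that by (auto simp: subset.chain_def)
    have dir: "\<exists>K\<in>\<C>. x \<in> K \<and> y \<in> K" if "x \<in> \<Union>\<C>" "y \<in> \<Union>\<C>" for x y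
    proof -
      from that obtain X Y where XY: "X \<in> \<C>" "x \<in> X" "Y \<in> \<C>" "y \<in> Y" by (elim UnionE)
      then have "X \<subseteq> Y \<or> Y \<subseteq> X" using ch by (simp add: subset_chain_def)
      then show ?thesis using XY by (metis subsetD)
    qed
    have "ring_ideal (\<Union>\<C>)"
      unfolding ring_ideal_def
    proof (intro conjI ballI allI)
      obtain I where "I \<in> \<C>" using ne by (meson ex_in_conv)
      then show "0 \<in> \<Union>\<C>" using sub[of I] ring_idealD(1)[of I] by auto
      show "x + y \<in> \<Union>\<C>" if xy: "x \<in> \<Union>\<C>" "y \<in> \<Union>\<C>" for x y
      proof -
        obtain K where "K \<in> \<C>" "x \<in> K" "y \<in> K" using dir[OF xy] by blast
        then show ?thesis using sub[of K] ring_idealD(2)[of K x y] by auto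
      qed
      show "r * x \<in> \<Union>\<C>" if x: "x \<in> \<Union>\<C>" for r x
      proof -
        obtain K where "K \<in> \<C>" "x \<in> K" using x by (elim UnionE)
        then show ?thesis using sub[of K] ring_idealD(3)[of K x r] by auto
      qed
    qed
    moreover have "J \<subseteq> \<Union>\<C>"
    proof -
      obtain I where "I \<in> \<C>" using ne by (meson ex_in_conv)
      then show ?thesis using sub[of I] by auto
    qed
    moreover have "1 \<notin> \<Union>\<C>" using sub by auto
    ultimately show "\<Union>\<C> \<in> ?A" by simp
  qed
  then obtain M where MA: "M \<in> ?A" and max: "\<forall>X\<in>?A. M \<subseteq> X \<longrightarrow> X = M" by (elim bexE)
  then have M: "ring_ideal M" "J \<subseteq> M" "1 \<notin> M" by simp_all
  have "\<exists>y. x * y - 1 \<in> M" if "x \<notin> M" for x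
  proof -
    define X where "X = {m + x * y | m y. m \<in> M}"
    have X_I: "m + x * y \<in> X" if "m \<in> M" for m y using that unfolding X_def by blast
    have X_E: "\<exists>m y. u = m + x * y \<and> m \<in> M" if "u \<in> X" for u using that unfolding X_def by blast
    have id: "ring_ideal X"
      unfolding ring_ideal_def
    proof (intro conjI ballI allI)
      show "0 \<in> X" using X_I[OF ring_idealD(1)[OF M(1)], of 0] by simp
      fix u assume "u \<in> X"
      then obtain m y where u: "u = m + x * y" "m \<in> M" using X_E by blast
      have "r * u = r * m + x * (r * y)" for r by (simp add: u(1) algebra_simps)
      then show "r * u \<in> X" for r using X_I[OF ring_idealD(3)[OF M(1) u(2), of r]] by simp
      fix v assume "v \<in> X"
      then obtain m' y' where v: "v = m' + x * y'" "m' \<in> M" using X_E by blast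
      have "u + v = (m + m') + x * (y + y')" by (simp add: u(1) v(1) algebra_simps)
      then show "u + v \<in> X" using X_I[OF ring_idealD(2)[OF M(1) u(2) v(2)]] by simp
    qed
    have sub: "M \<subseteq> X" using X_I[of _ 0] by auto
    have "x \<in> X" using X_I[OF ring_idealD(1)[OF M(1)], of 1] by simp
    then have "X \<noteq> M" using that by auto
    then have "X \<notin> ?A" using max sub by metis
    then have "1 \<in> X" using id order_trans[OF M(2) sub] by simp
    then obtain m y where "1 = m + x * y" "m \<in> M" using X_E by blast
    then have "x * y - 1 = - m" by (simp add: algebra_simps)
    then show ?thesis using ring_idealD(5)[OF M(1) \<open>m \<in> M\<close>] by metis
  qed
  then have "\<forall>x. x \<notin> M \<longrightarrow> (\<exists>y. x * y - 1 \<in> M)" by simp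
  then show ?thesis using M by (intro exI[of _ M] conjI)
qed

text \<open>Elements of the quotient are coded by natural numbers: a representative of the class is chosen in
\<open>Rep\<close>, which is finite, and \<open>Rep\<close> is embedded into the natural numbers.\<close>

lemma quotient_ring_on_nat:
  fixes M :: "'a::comm_ring_1 set"
  assumes M: "ring_ideal M" and fin: "finite Rep" and rep: "\<And>x. \<exists>r\<in>Rep. x - r \<in> M"
  shows "\<exists>(F :: nat ring) h. onto_ring_hom F h \<and> finite (carrier F) \<and> (\<forall>x. h x = \<zero>\<^bsub>F\<^esub> \<longleftrightarrow> x \<in> M)"
proof -
  obtain enc :: "'a \<Rightarrow> nat" where enc: "inj_on enc Rep"
    using finite_imp_inj_to_nat_seg[OF fin] by blast
  define red where "red x = (SOME r. r \<in> Rep \<and> x - r \<in> M)" for x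
  have red: "red x \<in> Rep" "x - red x \<in> M" for x
    using someI_ex[of "\<lambda>r. r \<in> Rep \<and> x - r \<in> M"] rep[of x] unfolding red_def by blast+
  have red_eq: "red x = red y \<longleftrightarrow> x - y \<in> M" for x y
  proof
    assume "red x = red y"
    then show "x - y \<in> M" using ring_idealD(6)[OF M red(2)[of x] red(2)[of y]] by simp
  next
    assume xy: "x - y \<in> M"
    have "(x - r \<in> M) = (y - r \<in> M)" for r
      using ring_idealD(6)[OF M _ xy, of "x - r"] ring_idealD(2)[OF M _ xy, of "y - r"]
      by auto
    then show "red x = red y" unfolding red_def by simp
  qed
  define h where "h x = enc (red x)" for x
  have h_eq: "h x = h y \<longleftrightarrow> x - y \<in> M" for x y
    using inj_on_eq_iff[OF enc red(1) red(1)] red_eq unfolding h_def by blast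
  define g where "g a = (SOME x. h x = a)" for a
  have "h (g (h x)) = h x" for x unfolding g_def by (rule someI) simp
  then have g: "g (h x) - x \<in> M" for x by (simp add: h_eq)
  define F where "F = \<lparr>carrier = range h, mult = (\<lambda>a b. h (g a * g b)), one = h 1,
    zero = h 0, add = (\<lambda>a b. h (g a + g b))\<rparr>"
  have add: "h (g (h x) + g (h y)) = h (x + y)" for x y
    using ring_idealD(2)[OF M g[of x] g[of y]] by (simp add: h_eq algebra_simps)
  have mult: "h (g (h x) * g (h y)) = h (x * y)" for x y
  proof -
    have "g (h x) * g (h y) - x * y = (g (h x) - x) * g (h y) + x * (g (h y) - y)"
      by (simp add: algebra_simps)
    then show ?thesis
      using ring_idealD(2)[OF M ring_idealD(4)[OF M g[of x], of "g (h y)"] ring_idealD(3)[OF M g[of y], of x]]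
      by (simp add: h_eq)
  qed
  have F: "carrier F = range h" "\<one>\<^bsub>F\<^esub> = h 1" "\<zero>\<^bsub>F\<^esub> = h 0"
    "h x \<oplus>\<^bsub>F\<^esub> h y = h (x + y)" "h x \<otimes>\<^bsub>F\<^esub> h y = h (x * y)" for x y
    by (simp_all add: F_def add mult)
  have "cring F"
  proof (intro cringI abelian_groupI comm_monoidI)
    fix a assume "a \<in> carrier F"
    then obtain x where x: "a = h x" by (auto simp: F)
    show "\<exists>b\<in>carrier F. b \<oplus>\<^bsub>F\<^esub> a = \<zero>\<^bsub>F\<^esub>"
      by (intro bexI[of _ "h (- x)"]) (auto simp: x F)
  qed (auto simp: F algebra_simps)
  then have "onto_ring_hom F h"
    by (intro onto_ring_hom.intro onto_ring_hom_axioms.intro) (auto simp: F)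
  moreover have "finite (carrier F)"
    by (rule finite_subset[of _ "enc ` Rep"]) (auto simp: F_def h_def red fin)
  moreover have "h x = \<zero>\<^bsub>F\<^esub> \<longleftrightarrow> x \<in> M" for x by (simp add: F_def h_eq)
  ultimately show ?thesis by blast
qed

text \<open>Modulo \<open>p\<close> the polynomial \<open>f\<close> is not zero and can be made monic.  Leading coefficients divisible by \<open>p\<close>
are moved into \<open>u\<close> until the leading coefficient is a unit modulo \<open>p\<close>.\<close>

lemma monic_modulo_prime:
  fixes f :: "int poly"
  assumes p: "prime p" and f: "\<not> [:p:] dvd f"
  shows "\<exists>c g u. [:c:] * f = g + [:p:] * u \<and> lead_coeff g = 1"
  using f
proof (induction "degree f" arbitrary: f rule: less_induct)
  case less
  show ?case
  proof (cases "p dvd lead_coeff f")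
    case True
    then obtain q where q: "lead_coeff f = p * q" by auto
    define f' where "f' = f - Polynomial.monom (lead_coeff f) (degree f)"
    have f: "f = f' + [:p:] * Polynomial.monom q (degree f)"
      by (simp add: f'_def q smult_monom)
    have nd: "\<not> [:p:] dvd f'"
    proof
      assume "[:p:] dvd f'"
      then have "[:p:] dvd f' + [:p:] * Polynomial.monom q (degree f)" by (intro dvd_add dvd_triv_left)
      then show False using less.prems by (simp only: f[symmetric])
    qed
    have "degree f \<noteq> 0"
    proof
      assume "degree f = 0"
      then obtain e where "f = [:e:]" by (rule degree_eq_zeroE)
      then have "f' = 0" by (simp add: f'_def monom_0)
      then show False using nd by simp
    qed
    then have "degree f' < degree f"
      by (intro degree_lessI) (auto simp: f'_def coeff_eq_0)
    from less.hyps[OF this nd] obtain c g u where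
      IH: "[:c:] * f' = g + [:p:] * u" "lead_coeff g = 1" by blast
    have "[:c:] * f = [:c:] * f' + [:c:] * ([:p:] * Polynomial.monom q (degree f))"
      using arg_cong[OF f, of "\<lambda>f. [:c:] * f"] by (simp only: distrib_left)
    also have "\<dots> = g + [:p:] * (u + [:c:] * Polynomial.monom q (degree f))"
      by (simp only: IH(1) distrib_left add.assoc mult.left_commute)
    finally have "[:c:] * f = g + [:p:] * (u + [:c:] * Polynomial.monom q (degree f))" .
    then show ?thesis using IH(2) by blast
  next
    case False
    then have "coprime (lead_coeff f) p" using p by (meson coprime_commute prime_imp_coprime)
    then have "gcd (lead_coeff f) p = 1" by simp
    then obtain c k' where "c * lead_coeff f + k' * p = 1"
      using bezout_int[of "lead_coeff f" p] by metis
    then have ck: "c * lead_coeff f = 1 + p * (- k')" by (simp add: algebra_simps)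
    define k where "k = - k'"
    note ck = ck[folded k_def]
    define g where "g = [:c:] * f - [:p:] * Polynomial.monom k (degree f)"
    have 1: "Polynomial.coeff g (degree f) = 1" using ck by (simp add: g_def)
    have "degree g \<le> degree f" by (intro degree_le) (simp add: g_def coeff_eq_0)
    moreover have "degree f \<le> degree g" using 1 by (intro le_degree) simp
    ultimately have "degree g = degree f" by simp
    with 1 have "lead_coeff g = 1" by simp
    moreover have "[:c:] * f = g + [:p:] * Polynomial.monom k (degree f)" by (simp add: g_def)
    ultimately show ?thesis by blast
  qed
qed

lemma prime_elem_dvd_prod:
  fixes q :: "'a::comm_semiring_1"
  assumes "finite S" "prime_elem q" "q dvd \<Prod>S"
  shows "\<exists>f\<in>S. q dvd f"
  using assms
proof (induction S rule: finite_induct)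
  case empty
  then show ?case by (simp add: prime_elem_def)
next
  case (insert f S)
  then show ?case by (auto dest: prime_elem_dvd_multD)
qed

text \<open>Euclid's argument.  Let \<open>g\<close> be a monic polynomial that is congruent modulo \<open>p\<close> to a constant multiple of the
product of \<open>S\<close>.
In a quotient field of \<open>\<int>[X]\<close> in which \<open>p\<close> and \<open>X g + 1\<close> become zero, \<open>g\<close> is invertible, so no member
of \<open>S\<close> becomes zero.  Such a quotient exists because \<open>p\<close> and \<open>X g + 1\<close> generate a proper ideal, and it is
finite because \<open>X g + 1\<close> is monic.\<close>

lemma finite_field_avoiding_roots:
  fixes S :: "int poly set"
  assumes p: "prime p" and fin: "finite S" and S: "\<And>f. f \<in> S \<Longrightarrow> \<not> [:int p:] dvd f"
  shows "\<exists>(F :: nat ring) h. field F \<and> finite (carrier F) \<and> ring_characteristic F = p \<and>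
    onto_ring_hom F h \<and> (\<forall>f\<in>S. h f \<noteq> \<zero>\<^bsub>F\<^esub>)"
proof -
  have pe: "prime_elem [:int p:]" using p by (simp add: prime_elem_const_poly_iff)
  have p': "prime (int p)" using p by simp
  have "\<not> [:int p:] dvd \<Prod>S" using prime_elem_dvd_prod[OF fin pe] S by auto
  from monic_modulo_prime[OF p' this] obtain c g u where
    g: "[:c:] * \<Prod>S = g + [:int p:] * u" "lead_coeff g = 1" by blast
  define Q where "Q = pCons 1 g"
  have g0: "g \<noteq> 0" using g(2) by auto
  have Q: "lead_coeff Q = 1" "degree Q \<noteq> 0" "Q \<noteq> 0" using g(2) g0 by (auto simp: Q_def)
  define J where "J = {[:int p:] * a + Q * b | a b. True}"
  have J_I: "[:int p:] * a + Q * b \<in> J" for a b unfolding J_def by blast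
  have J: "ring_ideal J"
    unfolding ring_ideal_def
  proof (intro conjI ballI allI)
    show "0 \<in> J" using J_I[of 0 0] by simp
    fix x assume "x \<in> J" then obtain a b where x: "x = [:int p:] * a + Q * b" unfolding J_def by auto
    have "r * x = [:int p:] * (r * a) + Q * (r * b)" for r
      unfolding x by (simp only: distrib_left mult.left_commute)
    then show "r * x \<in> J" for r by (simp only: J_I)
    fix y assume "y \<in> J" then obtain a' b' where y: "y = [:int p:] * a' + Q * b'" unfolding J_def by auto
    have "x + y = [:int p:] * (a + a') + Q * (b + b')"
      unfolding x y by (simp only: distrib_left add.assoc add.left_commute add.commute)
    then show "x + y \<in> J" by (simp only: J_I)
  qed
  have pJ: "[:int p:] * a \<in> J" for a using J_I[of a 0] by simp
  have QJ: "Q * b \<in> J" for b using J_I[of 0 b] by simp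
  have "1 \<notin> J"
  proof
    assume "1 \<in> J"
    then obtain a b where ab: "1 = [:int p:] * a + Q * b" unfolding J_def by auto
    have "\<not> [:int p:] dvd b"
    proof
      assume "[:int p:] dvd b"
      then have "[:int p:] dvd [:int p:] * a + Q * b" by (intro dvd_add dvd_triv_left dvd_mult)
      then have "[:int p:] dvd 1" by (simp only: ab[symmetric])
      then show False using pe unfolding prime_elem_def by blast
    qed
    from monic_modulo_prime[OF p' this] obtain c' g' u' where
      g': "[:c':] * b = g' + [:int p:] * u'" "lead_coeff g' = 1" by blast
    \<comment> \<open>A combination equal to \<open>1\<close> would make a constant congruent modulo \<open>p\<close> to the monic polynomial \<open>Q g\'\<close> of positive degree.\<close>
    have lc: "lead_coeff (Q * g') = 1" using Q(1) g'(2) by (simp add: lead_coeff_mult)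
    have deg: "degree (Q * g') \<noteq> 0"
      using Q g'(2) by (subst degree_mult_eq) auto
    have "[:c':] = [:c':] * ([:int p:] * a + Q * b)" unfolding ab[symmetric] by simp
    also have "\<dots> = [:int p:] * ([:c':] * a) + Q * ([:c':] * b)" by (simp only: algebra_simps)
    also have "\<dots> = [:int p:] * ([:c':] * a + Q * u') + Q * g'" unfolding g' by (simp only: algebra_simps)
    finally have eq: "[:c':] = [:int p:] * ([:c':] * a + Q * u') + Q * g'" .
    define W where "W = [:c':] * a + Q * u'"
    have "Polynomial.coeff [:c':] (degree (Q * g')) = Polynomial.coeff ([:int p:] * W + Q * g') (degree (Q * g'))"
      by (rule arg_cong[OF eq[folded W_def]])
    also have "\<dots> = int p * Polynomial.coeff W (degree (Q * g')) + 1" using lc by simp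
    finally have "1 = int p * - Polynomial.coeff W (degree (Q * g'))" using deg by (simp add: coeff_eq_0)
    then have "int p dvd 1" by (rule dvdI)
    then show False using p' by (simp add: prime_int_iff)
  qed
  from maximal_ideal_exists[OF J this] obtain M where
    M: "ring_ideal M" "J \<subseteq> M" "1 \<notin> M" and max: "\<And>x. x \<notin> M \<Longrightarrow> \<exists>y. x * y - 1 \<in> M" by blast
  define Rep where "Rep = Poly ` {xs. set xs \<subseteq> {0..<int p} \<and> length xs \<le> degree Q}"
  have finRep: "finite Rep" unfolding Rep_def by (intro finite_imageI finite_lists_length_le) simp
  \<comment> \<open>Division by the monic \<open>Q\<close>, followed by reduction of the coefficients modulo \<open>p\<close>.\<close>
  have rep: "\<exists>r\<in>Rep. f - r \<in> M" for f
  proof -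
    obtain q r where qr: "pseudo_divmod f Q = (q, r)" by (metis surj_pair)
    from pseudo_divmod[OF Q(3) qr] have f: "f = Q * q + r" and r: "r = 0 \<or> degree r < degree Q"
      by (simp_all add: Q(1))
    define r' where "r' = map_poly (\<lambda>c. c mod int p) r"
    have c': "Polynomial.coeff r' i = Polynomial.coeff r i mod int p" for i
      unfolding r'_def by (simp add: coeff_map_poly)
    have "r = [:int p:] * map_poly (\<lambda>c. c div int p) r + r'"
      by (intro poly_eqI) (simp add: c' coeff_map_poly)
    then have "f - r' = Q * q + [:int p:] * map_poly (\<lambda>c. c div int p) r"
      unfolding f by (metis add.assoc add_diff_cancel_right')
    then have 1: "f - r' \<in> M"
      using ring_idealD(2)[OF M(1) subsetD[OF M(2) QJ] subsetD[OF M(2) pJ]] by (simp only:)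
    have dr: "degree r' \<le> degree r" by (intro degree_le) (simp add: c' coeff_eq_0)
    have p0: "int p > 0" using prime_gt_0_nat[OF p] by simp
    have "x \<in> {0..<int p}" if "x \<in> set (coeffs r')" for x
    proof -
      have "x \<in> range (Polynomial.coeff r')" using that by (simp add: range_coeff)
      then obtain i where "x = Polynomial.coeff r' i" by (elim rangeE)
      then show ?thesis using p0 by (simp add: c')
    qed
    then have "set (coeffs r') \<subseteq> {0..<int p}" by blast
    moreover have "length (coeffs r') \<le> degree Q"
    proof (cases "r' = 0")
      case False
      then have "r \<noteq> 0" by (auto simp: r'_def)
      with r dr False show ?thesis by (simp add: length_coeffs_degree)
    qed simp
    ultimately have "r' \<in> Rep" unfolding Rep_def by (intro image_eqI[of _ _ "coeffs r'"]) simp_all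
    with 1 show ?thesis by blast
  qed
  from quotient_ring_on_nat[OF M(1) finRep rep] obtain F :: "nat ring" and h where
    F: "onto_ring_hom F h" "finite (carrier F)" and h0: "\<And>x. h x = \<zero>\<^bsub>F\<^esub> \<longleftrightarrow> x \<in> M" by blast
  interpret onto_ring_hom F h by fact
  have one0: "\<one>\<^bsub>F\<^esub> \<noteq> \<zero>\<^bsub>F\<^esub>" using h0[of 1] M(3) by (simp add: h_one)
  have field: "field F"
  proof (rule cring_fieldI2)
    show "\<zero>\<^bsub>F\<^esub> \<noteq> \<one>\<^bsub>F\<^esub>" using one0 by simp
    fix a assume "a \<in> carrier F" "a \<noteq> \<zero>\<^bsub>F\<^esub>"
    then obtain x where x: "a = h x" "x \<notin> M" by (auto simp: carrier_eq h0)
    obtain y where "x * y - 1 \<in> M" using max[OF x(2)] by blast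
    then have "h (x * y) = h 1" using h0 h_diff_zero_iff by blast
    then show "\<exists>b\<in>carrier F. a \<otimes>\<^bsub>F\<^esub> b = \<one>\<^bsub>F\<^esub>"
      by (intro bexI[of _ "h y"]) (simp_all add: x(1) h_mult h_one)
  qed
  have hp: "h [:int p:] = \<zero>\<^bsub>F\<^esub>" using h0 pJ[of 1] M(2) by auto
  have "ring_characteristic F = p"
  proof -
    let ?G = "add_monoid F"
    have "[p] \<cdot>\<^bsub>F\<^esub> \<one>\<^bsub>F\<^esub> = \<zero>\<^bsub>F\<^esub>" using hp by (simp add: h_of_nat[symmetric] of_nat_poly)
    then have "group.ord ?G \<one>\<^bsub>F\<^esub> dvd p"
      using group.pow_eq_id[OF a_group, of "\<one>\<^bsub>F\<^esub>" p] by (simp add: add_pow_def)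
    moreover have "group.ord ?G \<one>\<^bsub>F\<^esub> \<noteq> 1"
      using group.ord_eq_1[OF a_group, of "\<one>\<^bsub>F\<^esub>"] one0 by simp
    ultimately show ?thesis using p unfolding ring_characteristic_def by (metis prime_nat_iff)
  qed
  moreover have "h f \<noteq> \<zero>\<^bsub>F\<^esub>" if "f \<in> S" for f
  proof
    assume "h f = \<zero>\<^bsub>F\<^esub>"
    then have "f \<in> M" by (simp add: h0)
    then have "f * ([:c:] * \<Prod>(S - {f})) \<in> M" by (rule ring_idealD(4)[OF M(1)])
    moreover have "[:c:] * \<Prod>S = f * ([:c:] * \<Prod>(S - {f}))"
      by (subst prod.remove[OF fin that]) (simp only: mult.left_commute)
    ultimately have "g + [:int p:] * u \<in> M" by (simp only: g(1)[symmetric])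
    moreover have "[:int p:] * u \<in> M" by (rule subsetD[OF M(2) pJ])
    ultimately have "g + [:int p:] * u - [:int p:] * u \<in> M" by (rule ring_idealD(6)[OF M(1)])
    then have "g \<in> M" by (simp only: add_diff_cancel_right')
    then have "[:0, 1:] * g \<in> M" by (rule ring_idealD(3)[OF M(1)])
    moreover have "Q \<in> M" using subsetD[OF M(2) QJ[of 1]] by simp
    ultimately have "Q - [:0, 1:] * g \<in> M" by (intro ring_idealD(6)[OF M(1)])
    moreover have "Q - [:0, 1:] * g = 1" by (simp add: Q_def one_pCons)
    ultimately show False using M(3) by simp
  qed
  ultimately show ?thesis using field F by blast
qed

section \<open>Modules spanned by columns, over a quotient ring\<close>

definition column_module :: "('c::comm_ring_1 \<Rightarrow> 'a) \<Rightarrow> 'c mat \<Rightarrow> 'a vec set" where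
  "column_module h G = {map_vec h (G *\<^sub>v u) | u. u \<in> carrier_vec (dim_col G)}"

lemma mult_mat_vec_smult:
  fixes c :: "'a::comm_ring_1"
  assumes "A \<in> carrier_mat n k" "v \<in> carrier_vec k"
  shows "A *\<^sub>v (c \<cdot>\<^sub>v v) = c \<cdot>\<^sub>v (A *\<^sub>v v)"
  using assms by (intro eq_vecI) (auto simp: scalar_prod_def sum_distrib_left algebra_simps)

context onto_ring_hom
begin

text \<open>The bridge extends coefficientwise to polynomials, so that \<open>UP R\<close> is handled by the same lemmas as \<open>R\<close>.\<close>

lemma lift_poly: "onto_ring_hom (UP R) (\<lambda>f i. h (Polynomial.coeff f i))"
proof -
  let ?H = "\<lambda>f i. h (Polynomial.coeff f i)"
  interpret U: UP_cring R "UP R" by unfold_locales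
  have up: "?H f \<in> up R" for f
    by (intro mem_upI exI[of _ "degree f"]) (auto simp: coeff_eq_0 h_zero)
  show ?thesis
  proof (intro onto_ring_hom.intro onto_ring_hom_axioms.intro)
    show "cring (UP R)" by (rule U.UP_cring)
    show "carrier (UP R) = range ?H"
    proof
      show "range ?H \<subseteq> carrier (UP R)" using up by (auto simp: UP_def)
      show "carrier (UP R) \<subseteq> range ?H"
      proof
        fix f assume "f \<in> carrier (UP R)"
        then have f: "\<And>i. f i \<in> carrier R" "\<exists>N. bound \<zero> N f" by (auto simp: UP_def up_def)
        then obtain N where N: "bound \<zero> N f" by blast
        from f(1) have "\<forall>i. \<exists>x. h x = f i" by (metis carrier_eq imageE)
        then obtain g where g: "\<And>i. h (g i) = f i" by metis
        have "h (Polynomial.coeff (Poly (map g [0..<Suc N])) i) = f i" for i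
        proof (cases "i \<le> N")
          case True
          then show ?thesis by (simp add: coeff_Poly_eq nth_default_def g del: upt_Suc)
        next
          case False
          then show ?thesis using N by (simp add: coeff_Poly_eq nth_default_def h_zero bound_def del: upt_Suc)
        qed
        then show "f \<in> range ?H" by (auto intro!: image_eqI[of _ _ "Poly (map g [0..<Suc N])"] simp del: upt_Suc)
      qed
    qed
    show "?H (f + g) = ?H f \<oplus>\<^bsub>UP R\<^esub> ?H g" for f g
      using up[of f] up[of g] by (simp add: UP_def h_add)
    show "?H (f * g) = ?H f \<otimes>\<^bsub>UP R\<^esub> ?H g" for f g
      using up[of f] up[of g] by (simp add: UP_def coeff_mult h_sum h_mult)
    show "?H 1 = \<one>\<^bsub>UP R\<^esub>" by (auto simp: UP_def h_one h_zero coeff_1)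
  qed
qed

lemma ring_det_map_mat:
  assumes "A \<in> carrier_mat m m"
  shows "ring_det R (map_mat h A) = h (det A)"
proof -
  have "add_pow R (sign \<sigma>) (h x) = h (signof \<sigma> * x)" for \<sigma> :: "nat \<Rightarrow> nat" and x
  proof (cases "sign \<sigma> = 1")
    case True
    then show ?thesis using add.int_pow_1[of "h x"] by (simp add: add_pow_def)
  next
    case False
    then have s: "sign \<sigma> = - 1" by (simp add: sign_def split: if_splits)
    have "add_pow R (- 1 :: int) (h x) = \<ominus> h x"
      using add.int_pow_neg[of "h x" 1] add.int_pow_1[of "h x"] by (simp add: add_pow_def a_inv_def)
    then show ?thesis by (simp add: s h_uminus)
  qed
  moreover have "(\<Otimes>i\<in>{0..<m}. map_mat h A $$ (i, \<sigma> i)) = h (\<Prod>i\<in>{0..<m}. A $$ (i, \<sigma> i))"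
    if "\<sigma> permutes {0..<m}" for \<sigma>
  proof -
    have "\<sigma> i < m" if "i < m" for i using permutes_in_image[OF \<open>\<sigma> permutes _\<close>, of i] that by simp
    then have "(\<Otimes>i\<in>{0..<m}. map_mat h A $$ (i, \<sigma> i)) = (\<Otimes>i\<in>{0..<m}. h (A $$ (i, \<sigma> i)))"
      using assms by (intro finprod_cong') auto
    then show ?thesis by (simp add: h_prod)
  qed
  ultimately show ?thesis
    unfolding ring_det_def det_def'[OF assms] h_sum using assms
    by (auto intro!: finsum_cong')
qed

text \<open>Products upstairs respect equality modulo the kernel of \<open>h\<close>; this lets identities that only hold in
\<open>R\<close> be used inside computations upstairs.\<close>

lemma map_mat_mult_cong:
  assumes "A \<in> carrier_mat a b" "A' \<in> carrier_mat a b" "B \<in> carrier_mat b c" "B' \<in> carrier_mat b c"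
    and A: "map_mat h A = map_mat h A'" and B: "map_mat h B = map_mat h B'"
  shows "map_mat h (A * B) = map_mat h (A' * B')"
proof (rule eq_matI)
  fix i j assume ij: "i < dim_row (map_mat h (A' * B'))" "j < dim_col (map_mat h (A' * B'))"
  have "h (A $$ (i, l)) = h (A' $$ (i, l))" "h (B $$ (l, j)) = h (B' $$ (l, j))" if "l < b" for l
    using arg_cong[OF A, of "\<lambda>M. M $$ (i, l)"] arg_cong[OF B, of "\<lambda>M. M $$ (l, j)"] ij that assms(1-4) by auto
  then show "map_mat h (A * B) $$ (i, j) = map_mat h (A' * B') $$ (i, j)"
    using ij assms(1-4) by (auto simp: scalar_prod_def h_sum h_mult intro!: finsum_cong')
qed (use assms in auto)

lemma map_mat_mult_vec_cong:
  assumes "A \<in> carrier_mat a b" "A' \<in> carrier_mat a b" "u \<in> carrier_vec b" "u' \<in> carrier_vec b"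
    and A: "map_mat h A = map_mat h A'" and u: "map_vec h u = map_vec h u'"
  shows "map_vec h (A *\<^sub>v u) = map_vec h (A' *\<^sub>v u')"
proof (rule eq_vecI)
  fix i assume i: "i < dim_vec (map_vec h (A' *\<^sub>v u'))"
  have "h (A $$ (i, l)) = h (A' $$ (i, l))" "h (u $ l) = h (u' $ l)" if "l < b" for l
    using arg_cong[OF A, of "\<lambda>M. M $$ (i, l)"] arg_cong[OF u, of "\<lambda>M. M $ l"] i that assms(1-4) by auto
  then show "map_vec h (A *\<^sub>v u) $ i = map_vec h (A' *\<^sub>v u') $ i"
    using i assms(1-4) by (auto simp: scalar_prod_def h_sum h_mult intro!: finsum_cong')
qed (use assms in auto)

lemma free_module_module: "module R (free_module R n)"
  by (rule free_module_is_module) unfold_locales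

lemma carrier_free_module: "carrier (free_module R n) = map_vec h ` carrier_vec n"
proof
  show "map_vec h ` carrier_vec n \<subseteq> carrier (free_module R n)" by (auto simp: free_module_def)
  show "carrier (free_module R n) \<subseteq> map_vec h ` carrier_vec n"
  proof
    fix v assume v: "v \<in> carrier (free_module R n)"
    then have "\<forall>i. \<exists>x. i < n \<longrightarrow> h x = v $ i" by (auto simp: free_module_def carrier_eq) (metis imageE)
    then obtain g where "\<And>i. i < n \<Longrightarrow> h (g i) = v $ i" by metis
    then have "v = map_vec h (vec n g)" using v by (intro eq_vecI) (auto simp: free_module_def)
    then show "v \<in> map_vec h ` carrier_vec n" by auto
  qed
qed

lemma free_module_ops:
  assumes "u \<in> carrier_vec n" "v \<in> carrier_vec n"
  shows "map_vec h u \<oplus>\<^bsub>free_module R n\<^esub> map_vec h v = map_vec h (u + v)"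
    and "h c \<odot>\<^bsub>free_module R n\<^esub> map_vec h u = map_vec h (c \<cdot>\<^sub>v u)"
    and "\<zero>\<^bsub>free_module R n\<^esub> = map_vec h (0\<^sub>v n)"
  using assms by (auto simp: free_module_def h_add h_mult h_zero intro!: eq_vecI)

lemma free_module_finsum:
  assumes "\<And>j. j \<in> A \<Longrightarrow> w j \<in> carrier_vec n" "finite A"
  shows "(\<Oplus>\<^bsub>free_module R n\<^esub>j\<in>A. map_vec h (w j)) = map_vec h (vec n (\<lambda>i. \<Sum>j\<in>A. w j $ i))"
proof -
  interpret M: module R "free_module R n" by (rule free_module_module)
  show ?thesis
    using assms(2,1)
  proof (induction A rule: finite_induct)
    case empty
    then show ?case
      by (simp add: free_module_ops(3)[of "0\<^sub>v n" n "0\<^sub>v n"]) (simp add: zero_vec_def)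
  next
    case (insert a A)
    have cl: "map_vec h (w j) \<in> carrier (free_module R n)" if "j \<in> insert a A" for j
      using insert.prems[OF that] by (auto simp: carrier_free_module)
    have "(\<Oplus>\<^bsub>free_module R n\<^esub>j\<in>insert a A. map_vec h (w j)) =
      map_vec h (w a) \<oplus>\<^bsub>free_module R n\<^esub> map_vec h (vec n (\<lambda>i. \<Sum>j\<in>A. w j $ i))"
      using insert cl by (subst M.finsum_insert) auto
    also have "\<dots> = map_vec h (w a + vec n (\<lambda>i. \<Sum>j\<in>A. w j $ i))"
      using insert.prems by (intro free_module_ops) auto
    also have "w a + vec n (\<lambda>i. \<Sum>j\<in>A. w j $ i) = vec n (\<lambda>i. \<Sum>j\<in>insert a A. w j $ i)"
      using insert by (intro eq_vecI) auto
    finally show ?case .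
  qed
qed

lemma lincomb_cols:
  assumes G: "G \<in> carrier_mat n k" and dist: "distinct (cols (map_mat h G))"
    and u: "u \<in> carrier_vec k" "\<And>j. j < k \<Longrightarrow> a (col (map_mat h G) j) = h (u $ j)"
  shows "module.lincomb (free_module R n) a (set (cols (map_mat h G))) = map_vec h (G *\<^sub>v u)"
proof -
  interpret M: module R "free_module R n" by (rule free_module_module)
  let ?c = "\<lambda>j. col (map_mat h G) j"
  have col: "?c j = map_vec h (col G j)" if "j < k" for j using that G by auto
  have setc: "set (cols (map_mat h G)) = ?c ` {..<k}"
    using G by (auto simp: cols_def atLeast0LessThan)
  have inj: "inj_on ?c {..<k}"
    using dist G by (simp add: cols_def distinct_map atLeast0LessThan)
  have summand: "a (?c j) \<odot>\<^bsub>free_module R n\<^esub> ?c j = map_vec h (u $ j \<cdot>\<^sub>v col G j)" if "j < k" for j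
  proof -
    have "col G j \<in> carrier_vec n" using G by auto
    then show ?thesis using u(2)[OF that] that by (simp add: col free_module_ops(2)[of _ n "0\<^sub>v n"])
  qed
  have cl: "map_vec h (u $ j \<cdot>\<^sub>v col G j) \<in> carrier (free_module R n)" if "j < k" for j
    using that G by (auto simp: carrier_free_module)
  have "M.lincomb a (set (cols (map_mat h G))) = (\<Oplus>\<^bsub>free_module R n\<^esub>v\<in>?c ` {..<k}. a v \<odot>\<^bsub>free_module R n\<^esub> v)"
    unfolding M.lincomb_def setc ..
  also have "\<dots> = (\<Oplus>\<^bsub>free_module R n\<^esub>j\<in>{..<k}. a (?c j) \<odot>\<^bsub>free_module R n\<^esub> ?c j)"
    using summand cl by (intro M.finsum_reindex inj) auto
  also have "\<dots> = (\<Oplus>\<^bsub>free_module R n\<^esub>j\<in>{..<k}. map_vec h (u $ j \<cdot>\<^sub>v col G j))"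
    using summand cl by (intro M.finsum_cong') auto
  also have "\<dots> = map_vec h (vec n (\<lambda>i. \<Sum>j\<in>{..<k}. (u $ j \<cdot>\<^sub>v col G j) $ i))"
    using G by (intro free_module_finsum) auto
  also have "vec n (\<lambda>i. \<Sum>j\<in>{..<k}. (u $ j \<cdot>\<^sub>v col G j) $ i) = G *\<^sub>v u"
    using G u(1) by (intro eq_vecI) (auto simp: scalar_prod_def lessThan_atLeast0 mult.commute intro!: sum.cong)
  finally show ?thesis .
qed

lemma span_cols:
  assumes G: "G \<in> carrier_mat n k" and dist: "distinct (cols (map_mat h G))"
  shows "module.span R (free_module R n) (set (cols (map_mat h G))) = column_module h G"
proof -
  interpret M: module R "free_module R n" by (rule free_module_module)
  let ?c = "\<lambda>j. col (map_mat h G) j"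
  let ?S = "set (cols (map_mat h G))"
  have setc: "?S = ?c ` {..<k}" using G by (auto simp: cols_def atLeast0LessThan)
  have inj: "inj_on ?c {..<k}"
    using dist G by (simp add: cols_def distinct_map atLeast0LessThan)
  have sub: "?S \<subseteq> carrier (free_module R n)"
    using G unfolding setc by (auto simp: carrier_free_module)
  have "M.span ?S = {M.lincomb a ?S | a. a \<in> ?S \<rightarrow> carrier R}"
    by (intro M.finite_span sub) simp
  also have "\<dots> = column_module h G"
  proof (intro subset_antisym subsetI)
    fix v assume "v \<in> {M.lincomb a ?S | a. a \<in> ?S \<rightarrow> carrier R}"
    then obtain a where a: "a \<in> ?S \<rightarrow> carrier R" "v = M.lincomb a ?S" by blast
    have "\<forall>j. \<exists>x. j < k \<longrightarrow> h x = a (?c j)"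
      using a(1) unfolding setc by (auto simp: carrier_eq Pi_iff) (metis imageE lessThan_iff)
    then obtain g where g: "\<And>j. j < k \<Longrightarrow> h (g j) = a (?c j)" by metis
    have "v = map_vec h (G *\<^sub>v vec k g)"
      unfolding a(2) by (rule lincomb_cols[OF G dist]) (auto simp: g)
    then show "v \<in> column_module h G" using G unfolding column_module_def by auto
  next
    fix v assume "v \<in> column_module h G"
    then obtain u where u: "u \<in> carrier_vec k" "v = map_vec h (G *\<^sub>v u)"
      using G unfolding column_module_def by auto
    define a where "a w = h (u $ (the_inv_into {..<k} ?c w))" for w
    have "a (?c j) = h (u $ j)" if "j < k" for j
      using that by (simp add: a_def the_inv_into_f_f[OF inj])
    then have "v = M.lincomb a ?S" unfolding u(2) using lincomb_cols[OF G dist u(1), of a] by simp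
    moreover have "a \<in> ?S \<rightarrow> carrier R" by (auto simp: a_def)
    ultimately show "v \<in> {M.lincomb a ?S | a. a \<in> ?S \<rightarrow> carrier R}" by blast
  qed
  finally show ?thesis .
qed

lemma submodule_column_module:
  assumes G: "G \<in> carrier_mat n k"
  shows "submodule R (column_module h G) (free_module R n)"
proof (rule LinearCombinations.submodule.intro)
  show "module R (free_module R n)" by (rule free_module_module)
  have I: "map_vec h (G *\<^sub>v u) \<in> column_module h G" if "u \<in> carrier_vec k" for u
    using that G unfolding column_module_def by auto
  show "column_module h G \<subseteq> carrier (free_module R n)"
    using G unfolding column_module_def carrier_free_module by auto
  show "\<zero>\<^bsub>free_module R n\<^esub> \<in> column_module h G"
  proof -
    have "G *\<^sub>v 0\<^sub>v k = 0\<^sub>v n" using G by auto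
    then show ?thesis using I[of "0\<^sub>v k"] by (simp add: free_module_ops(3)[of "0\<^sub>v n" n "0\<^sub>v n"])
  qed
  fix v assume "v \<in> column_module h G"
  then obtain u where u: "u \<in> carrier_vec k" "v = map_vec h (G *\<^sub>v u)"
    using G unfolding column_module_def by auto
  show "c \<odot>\<^bsub>free_module R n\<^esub> v \<in> column_module h G" if c: "c \<in> carrier R" for c
  proof -
    obtain x where x: "c = h x" using c carrier_eq by auto
    have "G *\<^sub>v u \<in> carrier_vec n" by (rule mult_mat_vec_carrier[OF G u(1)])
    then show ?thesis using x u I[of "x \<cdot>\<^sub>v u"] mult_mat_vec_smult[OF G u(1), of x]
      by (simp add: free_module_ops(2)[of _ n "0\<^sub>v n"])
  qed
  fix w assume "w \<in> column_module h G"
  then obtain u' where u': "u' \<in> carrier_vec k" "w = map_vec h (G *\<^sub>v u')"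
    using G unfolding column_module_def by auto
  show "v \<oplus>\<^bsub>free_module R n\<^esub> w \<in> column_module h G"
    using u u' G I[of "u + u'"] by (simp add: free_module_ops(1) mult_add_distrib_mat_vec)
qed

lemma vec_of_left_inverse:
  assumes G: "G \<in> carrier_mat n k" and X: "X \<in> carrier_mat k n"
    and XG: "map_mat h (X * G) = map_mat h (1\<^sub>m k)" and u: "u \<in> carrier_vec k"
  shows "map_vec h (X *\<^sub>v (G *\<^sub>v u)) = map_vec h u"
proof -
  have "map_vec h (X *\<^sub>v (G *\<^sub>v u)) = map_vec h ((X * G) *\<^sub>v u)"
    using G X u by (simp add: assoc_mult_mat_vec)
  also have "\<dots> = map_vec h (1\<^sub>m k *\<^sub>v u)"
    using G X u by (intro map_mat_mult_vec_cong XG refl) auto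
  finally show ?thesis using u by simp
qed

text \<open>If \<open>X G = 1\<close>, then \<open>G X\<close> is a projection onto the column module, and the kernel of \<open>X\<close> is a complement.\<close>

lemma direct_summand_column_module:
  assumes G: "G \<in> carrier_mat n k" and X: "X \<in> carrier_mat k n"
    and XG: "map_mat h (X * G) = map_mat h (1\<^sub>m k)"
  shows "direct_summand (column_module h G) R (free_module R n)"
proof -
  let ?M = "free_module R n"
  define D where "D = {map_vec h v | v. v \<in> carrier_vec n \<and> map_vec h (X *\<^sub>v v) = map_vec h (0\<^sub>v k)}"
  note ops = free_module_ops
  have DI: "map_vec h v \<in> D" if "v \<in> carrier_vec n" "map_vec h (X *\<^sub>v v) = map_vec h (0\<^sub>v k)" for v
    using that unfolding D_def by blast
  have z: "\<zero>\<^bsub>?M\<^esub> = map_vec h (0\<^sub>v n)" by (rule ops(3)[of "0\<^sub>v n" n "0\<^sub>v n"]) auto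
  have X0: "X *\<^sub>v 0\<^sub>v n = 0\<^sub>v k" using X by auto
  have h0iff: "map_vec h v = map_vec h (0\<^sub>v k) \<longleftrightarrow> (\<forall>i<k. h (v $ i) = \<zero>)" if "v \<in> carrier_vec k" for v
    using that by (auto simp: vec_eq_iff h_zero)
  have D: "submodule R D ?M"
  proof (rule LinearCombinations.submodule.intro)
    show "module R ?M" by (rule free_module_module)
    show "D \<subseteq> carrier ?M" unfolding D_def carrier_free_module by auto
    show "\<zero>\<^bsub>?M\<^esub> \<in> D" unfolding z by (rule DI) (simp_all add: X0)
    fix v assume "v \<in> D"
    then obtain v' where v: "v = map_vec h v'" "v' \<in> carrier_vec n" "map_vec h (X *\<^sub>v v') = map_vec h (0\<^sub>v k)"
      unfolding D_def by blast
    show "c \<odot>\<^bsub>?M\<^esub> v \<in> D" if c: "c \<in> carrier R" for c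
    proof -
      obtain x where x: "c = h x" using c carrier_eq by auto
      have "map_vec h (x \<cdot>\<^sub>v v') \<in> D"
        using v X h0iff[of "X *\<^sub>v v'"] h0iff[of "x \<cdot>\<^sub>v (X *\<^sub>v v')"]
        by (intro DI) (auto simp: mult_mat_vec_smult[OF X v(2)] h_mult)
      then show ?thesis using v x by (simp add: ops(2)[of _ n "0\<^sub>v n"])
    qed
    fix w assume "w \<in> D"
    then obtain w' where w: "w = map_vec h w'" "w' \<in> carrier_vec n" "map_vec h (X *\<^sub>v w') = map_vec h (0\<^sub>v k)"
      unfolding D_def by blast
    have "map_vec h (v' + w') \<in> D"
      using v w X h0iff[of "X *\<^sub>v v'"] h0iff[of "X *\<^sub>v w'"] h0iff[of "X *\<^sub>v v' + X *\<^sub>v w'"]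
      by (intro DI) (auto simp: mult_add_distrib_mat_vec h_add simp del: index_mult_mat_vec)
    then show "v \<oplus>\<^bsub>?M\<^esub> w \<in> D" using v w by (simp add: ops(1))
  qed
  have int: "column_module h G \<inter> D = {\<zero>\<^bsub>?M\<^esub>}"
  proof -
    have "w = \<zero>\<^bsub>?M\<^esub>" if wC: "w \<in> column_module h G" and wD: "w \<in> D" for w
    proof -
      obtain u where u: "u \<in> carrier_vec k" "w = map_vec h (G *\<^sub>v u)"
        using wC G unfolding column_module_def by auto
      obtain v where v: "v \<in> carrier_vec n" "w = map_vec h v" "map_vec h (X *\<^sub>v v) = map_vec h (0\<^sub>v k)"
        using wD unfolding D_def by blast
      have "map_vec h u = map_vec h (X *\<^sub>v (G *\<^sub>v u))"
        using vec_of_left_inverse[OF G X XG u(1)] by simp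
      also have "\<dots> = map_vec h (X *\<^sub>v v)"
        using u v G X by (intro map_mat_mult_vec_cong[OF X X]) auto
      finally have "map_vec h u = map_vec h (0\<^sub>v k)" using v(3) by simp
      then have "w = map_vec h (G *\<^sub>v 0\<^sub>v k)"
        unfolding u(2) using u G by (intro map_mat_mult_vec_cong[OF G G]) auto
      moreover have "G *\<^sub>v 0\<^sub>v k = 0\<^sub>v n" using G by auto
      ultimately show ?thesis by (simp add: z)
    qed
    moreover have "\<zero>\<^bsub>?M\<^esub> \<in> column_module h G" "\<zero>\<^bsub>?M\<^esub> \<in> D"
      using submodule_column_module[OF G] D by (auto simp: submodule_def)
    ultimately show ?thesis by blast
  qed
  have "column_module h G <+>\<^bsub>?M\<^esub> D = carrier ?M"
  proof
    interpret M: module R ?M by (rule free_module_module)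
    show "column_module h G <+>\<^bsub>?M\<^esub> D \<subseteq> carrier ?M"
    proof
      fix w assume "w \<in> column_module h G <+>\<^bsub>?M\<^esub> D"
      then obtain x y where w: "x \<in> column_module h G" "y \<in> D" "w = x \<oplus>\<^bsub>?M\<^esub> y"
        unfolding set_add_def' by blast
      then have "x \<in> carrier ?M" "y \<in> carrier ?M"
        using submodule.subset[OF submodule_column_module[OF G]] submodule.subset[OF D] by auto
      then show "w \<in> carrier ?M" unfolding w(3) by (rule M.a_closed)
    qed
    show "carrier ?M \<subseteq> column_module h G <+>\<^bsub>?M\<^esub> D"
    proof
      fix w assume "w \<in> carrier ?M"
      then obtain v where v: "v \<in> carrier_vec n" "w = map_vec h v" unfolding carrier_free_module by blast
      let ?g = "G *\<^sub>v (X *\<^sub>v v)"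
      have g: "?g \<in> carrier_vec n" using G X v by auto
      have "map_vec h ?g \<in> column_module h G" using G X v unfolding column_module_def by auto
      moreover have "map_vec h (v - ?g) \<in> D"
      proof (rule DI)
        have eq: "map_vec h (X *\<^sub>v ?g) = map_vec h (X *\<^sub>v v)"
          using vec_of_left_inverse[OF G X XG, of "X *\<^sub>v v"] X v by auto
        have "h ((X *\<^sub>v v) $ i) = h ((X *\<^sub>v ?g) $ i)" if "i < k" for i
          using arg_cong[OF eq, of "\<lambda>z. z $ i"] that X v by auto
        then have "\<forall>i<k. h ((X *\<^sub>v v - X *\<^sub>v ?g) $ i) = \<zero>"
          using X v g by (auto simp: h_diff_zero_iff simp del: index_mult_mat_vec)
        moreover have "X *\<^sub>v (v - ?g) = X *\<^sub>v v - X *\<^sub>v ?g" using X v g by (simp add: mult_minus_distrib_mat_vec)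
        moreover have "X *\<^sub>v v - X *\<^sub>v ?g \<in> carrier_vec k" using X by (intro carrier_vecI) auto
        ultimately show "map_vec h (X *\<^sub>v (v - ?g)) = map_vec h (0\<^sub>v k)" using h0iff by metis
      qed (use v g in auto)
      moreover have "w = map_vec h ?g \<oplus>\<^bsub>?M\<^esub> map_vec h (v - ?g)"
      proof -
        have "a + (v - a) = v" if "a \<in> carrier_vec n" for a using v(1) that by (intro eq_vecI) auto
        from this[OF g] show ?thesis using v g ops(1)[OF g, of "v - ?g"] by simp
      qed
      ultimately show "w \<in> column_module h G <+>\<^bsub>?M\<^esub> D" unfolding set_add_def' by blast
    qed
  qed
  then show ?thesis unfolding direct_summand_def using submodule_column_module[OF G] D int by blast
qed

text \<open>Multiplication by \<open>X\<close> recovers the coefficients of a linear combination of the columns.\<close>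

lemma left_invertible_cols:
  assumes G: "G \<in> carrier_mat n k" and X: "X \<in> carrier_mat k n"
    and XG: "map_mat h (X * G) = map_mat h (1\<^sub>m k)" and "\<one> \<noteq> \<zero>"
  shows "distinct (cols (map_mat h G))"
    and "\<not> module.lin_dep R (free_module R n) (set (cols (map_mat h G)))"
proof -
  interpret M: module R "free_module R n" by (rule free_module_module)
  let ?c = "\<lambda>j. col (map_mat h G) j"
  have entry: "h (\<Sum>l\<in>{0..<n}. X $$ (j, l) * G $$ (l, i)) = (if j = i then \<one> else \<zero>)" if "i < k" "j < k" for i j
    using arg_cong[OF XG, of "\<lambda>z. z $$ (j, i)"] that G X by (auto simp: scalar_prod_def h_one h_zero)
  have inj: "inj_on ?c {..<k}"
  proof
    fix i j assume ij: "i \<in> {..<k}" "j \<in> {..<k}" "?c i = ?c j"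
    have "?c i' $ l = h (G $$ (l, i'))" if "l < n" "i' < k" for l i' using that G by simp
    then have "h (G $$ (l, i)) = h (G $$ (l, j))" if "l < n" for l
      using ij that by (metis lessThan_iff)
    then have "h (\<Sum>l\<in>{0..<n}. X $$ (j, l) * G $$ (l, i)) = h (\<Sum>l\<in>{0..<n}. X $$ (j, l) * G $$ (l, j))"
      by (auto simp: h_sum h_mult intro!: finsum_cong')
    then show "i = j" using entry[of i j] entry[of j j] ij assms(4) by (auto split: if_splits)
  qed
  then show dist: "distinct (cols (map_mat h G))"
    using G by (simp add: cols_def distinct_map atLeast0LessThan)
  let ?S = "set (cols (map_mat h G))"
  have setc: "?S = ?c ` {..<k}" using G by (auto simp: cols_def atLeast0LessThan)
  have sub: "?S \<subseteq> carrier (free_module R n)"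
    using G unfolding setc by (auto simp: carrier_free_module)
  show "\<not> M.lin_dep ?S"
  proof (rule M.finite_lin_indpt2[OF _ sub])
    show "finite ?S" by simp
    fix a assume a: "a \<in> ?S \<rightarrow> carrier R" "M.lincomb a ?S = \<zero>\<^bsub>free_module R n\<^esub>"
    have "\<forall>j. \<exists>x. j < k \<longrightarrow> h x = a (?c j)"
      using a(1) unfolding setc by (auto simp: carrier_eq Pi_iff) (metis imageE lessThan_iff)
    then obtain g where g: "\<And>j. j < k \<Longrightarrow> h (g j) = a (?c j)" by metis
    define u where "u = vec k g"
    have u: "u \<in> carrier_vec k" by (simp add: u_def)
    have "map_vec h (G *\<^sub>v u) = map_vec h (0\<^sub>v n)"
      using lincomb_cols[OF G dist u, of a] a(2) free_module_ops(3)[of "0\<^sub>v n" n "0\<^sub>v n"] by (simp add: u_def g)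
    then have XGu: "map_vec h (X *\<^sub>v (G *\<^sub>v u)) = map_vec h (X *\<^sub>v 0\<^sub>v n)"
      using G u by (intro map_mat_mult_vec_cong[OF X X]) auto
    have "map_vec h u = map_vec h (0\<^sub>v k)"
    proof -
      have "X *\<^sub>v 0\<^sub>v n = 0\<^sub>v k" using X by auto
      then show ?thesis using XGu vec_of_left_inverse[OF G X XG u] by simp
    qed
    then have "a (?c j) = \<zero>" if "j < k" for j
      using arg_cong[of _ _ "\<lambda>z. z $ j"] that g[OF that] by (metis h_zero index_map_vec(1) index_vec index_zero_vec u_def dim_vec)
    then show "\<forall>v\<in>?S. a v = \<zero>" unfolding setc by blast
  qed
qed

end

section \<open>Codes from left invertible polynomial matrices\<close>

lemma submatrix_mult_right:
  fixes A :: "'a::comm_ring_1 mat"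
  assumes "A \<in> carrier_mat n k" "B \<in> carrier_mat k m" "I \<subseteq> {..<n}"
  shows "submatrix (A * B) I UNIV = submatrix A I UNIV * B"
proof (rule eq_matI)
  have card: "{i. i < n \<and> i \<in> I} = I" using assms by auto
  fix i j assume "i < dim_row (submatrix A I UNIV * B)" "j < dim_col (submatrix A I UNIV * B)"
  then have i: "i < card I" and j: "j < m" using assms by (auto simp: dim_submatrix card)
  have p: "pick I i < n" using pick_in_set_le[OF i] assms(3) by auto
  have "submatrix A I UNIV $$ (i, l) = A $$ (pick I i, l)" if "l < k" for l
    using that i assms by (subst submatrix_index) (auto simp: card pick_UNIV)
  then show "submatrix (A * B) I UNIV $$ (i, j) = (submatrix A I UNIV * B) $$ (i, j)"
    using i j p assms
    by (subst submatrix_index) (auto simp: card pick_UNIV scalar_prod_def dim_submatrix intro!: sum.cong)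
qed (use assms in \<open>auto simp: dim_submatrix\<close>)

context onto_ring_hom
begin

lemma column_module_subset_factor:
  assumes A: "A \<in> carrier_mat n m" and G: "G \<in> carrier_mat n k"
    and sub: "column_module h A \<subseteq> column_module h G"
  shows "\<exists>U\<in>carrier_mat k m. map_mat h A = map_mat h (G * U)"
proof -
  have "\<exists>u. u \<in> carrier_vec k \<and> map_vec h (col A j) = map_vec h (G *\<^sub>v u)" if "j < m" for j
  proof -
    have "A *\<^sub>v unit_vec m j = col A j"
      using A that by (intro eq_vecI) auto
    then have "map_vec h (col A j) \<in> column_module h A"
      unfolding column_module_def using A by (auto intro!: exI[of _ "unit_vec m j"])
    then show ?thesis using sub G unfolding column_module_def by auto
  qed
  then obtain u where u: "\<And>j. j < m \<Longrightarrow> u j \<in> carrier_vec k"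
    "\<And>j. j < m \<Longrightarrow> map_vec h (col A j) = map_vec h (G *\<^sub>v u j)" by metis
  define U where "U = mat k m (\<lambda>(i, j). u j $ i)"
  have "map_mat h A = map_mat h (G * U)"
  proof (rule eq_matI)
    fix i j assume ij: "i < dim_row (map_mat h (G * U))" "j < dim_col (map_mat h (G * U))"
    then have i: "i < n" and j: "j < m" using G by (auto simp: U_def)
    have "col U j = u j" using u(1)[OF j] j by (intro eq_vecI) (auto simp: U_def)
    moreover have "map_vec h (col A j) $ i = h (A $$ (i, j))" using A i j by simp
    moreover have "map_vec h (G *\<^sub>v u j) $ i = h (row G i \<bullet> u j)" using G i by simp
    ultimately show "map_mat h A $$ (i, j) = map_mat h (G * U) $$ (i, j)"
      using ij i j A G u(2)[OF j] by (simp add: U_def)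
  qed (use A G in \<open>auto simp: U_def\<close>)
  then show ?thesis by (intro bexI[of _ U]) (auto simp: U_def)
qed

lemma det_cong:
  assumes "A \<in> carrier_mat m m" "B \<in> carrier_mat m m" "map_mat h A = map_mat h B"
  shows "h (det A) = h (det B)"
  using assms by (metis ring_det_map_mat)

end

text \<open>The degree does not depend on the generator matrix: two generator matrices differ by a square matrix
\<open>W\<close> that is invertible because \<open>G\<close> has a left inverse.  The determinant of \<open>W\<close> is a unit of \<open>F[s]\<close>, hence
has degree \<open>0\<close>, and all \<open>k \<times> k\<close> minors are multiplied by it.\<close>

lemma column_module_code:
  fixes F :: "('a, 'b) ring_scheme" and h :: "'c::comm_ring_1 \<Rightarrow> 'a"
    and G X :: "'c poly mat" and n k \<delta> :: nat
  defines "H \<equiv> (\<lambda>f i. h (Polynomial.coeff f i))"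
  assumes F: "onto_ring_hom F h" "field F"
    and G: "G \<in> carrier_mat n k" and X: "X \<in> carrier_mat k n"
    and XG: "map_mat H (X * G) = map_mat H (1\<^sub>m k)"
  shows "convolutional_code F n k (column_module H G)"
    and "\<lbrakk>\<And>I. I \<subseteq> {..<n} \<Longrightarrow> card I = k \<Longrightarrow> degree (det (submatrix G I UNIV)) \<le> \<delta>;
          I0 \<subseteq> {..<n}; card I0 = k; h (Polynomial.coeff (det (submatrix G I0 UNIV)) \<delta>) \<noteq> \<zero>\<^bsub>F\<^esub>\<rbrakk>
      \<Longrightarrow> code_degree F n k (column_module H G) = \<delta>"
proof -
  let ?P = "UP F"
  interpret F: onto_ring_hom F h by fact
  interpret Ff: field F by fact
  interpret U: onto_ring_hom ?P H unfolding H_def by (rule F.lift_poly)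
  interpret D: UP_domain F ?P by unfold_locales
  have nz: "\<one>\<^bsub>?P\<^esub> \<noteq> \<zero>\<^bsub>?P\<^esub>" by simp
  note cols = U.left_invertible_cols[OF G X XG nz]
  have Hc: "up_ring.coeff ?P (H f) i = h (Polynomial.coeff f i)" for f i
    using U.h_closed[of f] by (simp add: UP_def H_def)
  let ?G = "map_mat H G"
  have sub: "set (cols ?G) \<subseteq> carrier (free_module ?P n)"
    using G by (auto simp: U.carrier_free_module cols_def)
  have gen: "generator_matrix F n k (column_module H G) ?G"
    unfolding generator_matrix_def using G cols sub U.span_cols[OF G cols(1)] by auto
  have "card (set (cols ?G)) = k" using cols(1) G by (simp add: distinct_card)
  moreover have "set (cols ?G) \<subseteq> column_module H G"
    using module.in_own_span[OF U.free_module_module sub] U.span_cols[OF G cols(1)] by simp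
  ultimately have "free_of_rank (column_module H G) ?P (free_module ?P n) k"
    unfolding free_of_rank_def using cols U.span_cols[OF G cols(1)]
    by (intro exI[of _ "set (cols ?G)"]) simp
  then show "convolutional_code F n k (column_module H G)"
    unfolding convolutional_code_def using U.direct_summand_column_module[OF G X XG] by blast
  assume bound: "\<And>I. I \<subseteq> {..<n} \<Longrightarrow> card I = k \<Longrightarrow> degree (det (submatrix G I UNIV)) \<le> \<delta>"
    and I0: "I0 \<subseteq> {..<n}" "card I0 = k" "h (Polynomial.coeff (det (submatrix G I0 UNIV)) \<delta>) \<noteq> \<zero>\<^bsub>F\<^esub>"
  have sm: "submatrix A I UNIV \<in> carrier_mat k k" if "A \<in> carrier_mat n k" "I \<subseteq> {..<n}" "card I = k"
    for A :: "'c poly mat" and I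
  proof -
    have "{i. i < n \<and> i \<in> I} = I" using that by auto
    then show ?thesis using that by (intro carrier_matI) (simp_all add: dim_submatrix)
  qed
  have sm': "submatrix (map_mat H A) I UNIV = map_mat H (submatrix A I UNIV)" if "A \<in> carrier_mat n k" "I \<subseteq> {..<n}" for A I
  proof (rule eq_matI)
    have card: "{i. i < n \<and> i \<in> I} = I" using that by auto
    fix i j assume "i < dim_row (map_mat H (submatrix A I UNIV))" "j < dim_col (map_mat H (submatrix A I UNIV))"
    then have i: "i < card I" and j: "j < k" using that by (auto simp: dim_submatrix card)
    have "pick I i < n" using pick_in_set_le[OF i] that(2) by auto
    then show "submatrix (map_mat H A) I UNIV $$ (i, j) = map_mat H (submatrix A I UNIV) $$ (i, j)"
      using i j that by (simp add: submatrix_index dim_submatrix card pick_UNIV)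
  qed (use that in \<open>auto simp: dim_submatrix\<close>)
  \<comment> \<open>An arbitrary generator matrix is lifted to a matrix \<open>A\<close> upstairs; \<open>W\<close> and \<open>V\<close> express \<open>A\<close> and \<open>G\<close> by each other.\<close>
  have unit_deg: "deg F (ring_det ?P (submatrix G' I UNIV)) = deg F (H (det (submatrix G I UNIV)))"
    if G': "generator_matrix F n k (column_module H G) G'" and I: "I \<subseteq> {..<n}" "card I = k" for G' I
  proof -
    have G'c: "G' \<in> carrier_mat n k" and G'e: "set (cols G') \<subseteq> carrier (free_module ?P n)"
      and G'd: "distinct (cols G')" and G's: "module.span ?P (free_module ?P n) (set (cols G')) = column_module H G"
      using G' unfolding generator_matrix_def by auto
    have "\<exists>x. H x = G' $$ (i, j)" if "i < n" "j < k" for i j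
    proof -
      have "col G' j \<in> carrier (free_module ?P n)" using G'e G'c that by (auto simp: cols_def)
      then have "col G' j $ i \<in> carrier ?P" using that by (simp add: free_module_def)
      then show ?thesis using that G'c U.carrier_eq by auto
    qed
    then obtain g where g: "\<And>i j. i < n \<Longrightarrow> j < k \<Longrightarrow> H (g i j) = G' $$ (i, j)" by metis
    define A where "A = mat n k (\<lambda>(i, j). g i j)"
    have A: "A \<in> carrier_mat n k" by (simp add: A_def)
    have G'A: "G' = map_mat H A" using G'c g by (intro eq_matI) (auto simp: A_def)
    have CA: "column_module H A = column_module H G"
      using U.span_cols[OF A] G'd G's unfolding G'A by simp
    obtain W where W: "W \<in> carrier_mat k k" "map_mat H A = map_mat H (G * W)"
      using U.column_module_subset_factor[OF A G] CA by auto
    obtain V where V: "V \<in> carrier_mat k k" "map_mat H G = map_mat H (A * V)"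
      using U.column_module_subset_factor[OF G A] CA by auto
    have "map_mat H (1\<^sub>m k) = map_mat H (X * (A * V))"
      unfolding XG[symmetric] using X G A V by (intro U.map_mat_mult_cong[OF X X]) auto
    also have "\<dots> = map_mat H (X * ((G * W) * V))"
      using X G A V W by (intro U.map_mat_mult_cong[OF X X] U.map_mat_mult_cong[of A n k "G * W"]) auto
    also have "X * ((G * W) * V) = (X * G) * (W * V)"
      using assoc_mult_mat[OF G W(1) V(1)] assoc_mult_mat[OF X G, of "W * V" k] W(1) V(1) by simp
    also have "map_mat H \<dots> = map_mat H (1\<^sub>m k * (W * V))"
      using X G V W XG by (intro U.map_mat_mult_cong) auto
    finally have "map_mat H (W * V) = map_mat H (1\<^sub>m k)" using W V by simp
    then have "H (det (W * V)) = H (det (1\<^sub>m k))" using W V by (intro U.det_cong) auto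
    then have one: "H (det W) \<otimes>\<^bsub>?P\<^esub> H (det V) = \<one>\<^bsub>?P\<^esub>"
      using W V by (simp add: det_mult U.h_mult U.h_one)
    then have nzW: "H (det W) \<noteq> \<zero>\<^bsub>?P\<^esub>" and nzV: "H (det V) \<noteq> \<zero>\<^bsub>?P\<^esub>"
      using nz by (metis U.h_closed U.l_null, metis U.h_closed U.r_null)
    have "deg F (H (det W)) + deg F (H (det V)) = 0"
      using D.deg_mult[OF nzW nzV] one by simp
    then have degW: "deg F (H (det W)) = 0" by simp
    have "map_mat H (submatrix A I UNIV) = map_mat H (submatrix (G * W) I UNIV)"
      using W(2) sm'[OF A I(1)] sm'[of "G * W" I] G W(1) I by simp
    then have "H (det (submatrix A I UNIV)) = H (det (submatrix (G * W) I UNIV))"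
      using sm[OF A I] sm[of "G * W" I] G W(1) I by (intro U.det_cong) auto
    also have "det (submatrix (G * W) I UNIV) = det (submatrix G I UNIV) * det W"
      unfolding submatrix_mult_right[OF G W(1) I(1)] using sm[OF G I] W(1) by (rule det_mult)
    finally have eq: "H (det (submatrix A I UNIV)) = H (det (submatrix G I UNIV)) \<otimes>\<^bsub>?P\<^esub> H (det W)"
      by (simp add: U.h_mult)
    have rd: "ring_det ?P (submatrix G' I UNIV) = H (det (submatrix A I UNIV))"
      unfolding G'A sm'[OF A I(1)] by (rule U.ring_det_map_mat[OF sm[OF A I]])
    show ?thesis
    proof (cases "H (det (submatrix G I UNIV)) = \<zero>\<^bsub>?P\<^esub>")
      case True
      then show ?thesis unfolding rd eq by simp
    next
      case False
      then show ?thesis unfolding rd eq using D.deg_mult[OF False nzW] degW by simp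
    qed
  qed
  have le: "deg F (H (det (submatrix G I UNIV))) \<le> \<delta>" if "I \<subseteq> {..<n}" "card I = k" for I
  proof (rule D.deg_aboveI)
    fix m assume "\<delta> < m"
    then show "up_ring.coeff ?P (H (det (submatrix G I UNIV))) m = \<zero>\<^bsub>F\<^esub>"
      using bound[OF that] by (simp add: Hc coeff_eq_0 F.h_zero)
  qed simp
  have ge: "\<delta> \<le> deg F (H (det (submatrix G I0 UNIV)))"
    using I0(3) by (intro D.deg_belowI) (auto simp: Hc)
  define S where "S = {deg F (ring_det ?P (submatrix G' I UNIV)) | G' I.
            generator_matrix F n k (column_module H G) G' \<and> I \<subseteq> {..<n} \<and> card I = k}"
  have all: "x \<le> \<delta>" if "x \<in> S" for x using that unit_deg le unfolding S_def by auto
  have "deg F (ring_det ?P (submatrix ?G I0 UNIV)) \<in> S" unfolding S_def using gen I0 by blast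
  moreover have "deg F (ring_det ?P (submatrix ?G I0 UNIV)) = \<delta>"
    using unit_deg[OF gen I0(1,2)] le[OF I0(1,2)] ge by simp
  ultimately have "\<delta> \<in> S" by simp
  moreover have "finite S" using finite_nat_set_iff_bounded_le all by blast
  ultimately show "code_degree F n k (column_module H G) = \<delta>"
    unfolding code_degree_def S_def[symmetric] using all by (intro Max_eqI)
qed

section \<open>The generator matrix and its minors\<close>

definition column_degree :: "nat \<Rightarrow> nat \<Rightarrow> nat \<Rightarrow> nat" where
  "column_degree k \<delta> j = \<delta> div k + (if k - \<delta> mod k \<le> j then 1 else 0)"

text \<open>The coefficient of \<open>s\<^sup>d\<close> in the entry \<open>(i, j)\<close> of the generator matrix.  The exponent is the squared difference
of the position \<open>n * t + i\<close> of a symbol of \<open>v\<^sub>t\<close> and the weight \<open>n * \<tau> + j\<close> of a symbol of \<open>u\<^sub>\<tau>\<close> if \<open>d = t - \<tau>\<close>.\<close>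

definition gen_coeff :: "nat \<Rightarrow> nat \<Rightarrow> nat \<Rightarrow> nat \<Rightarrow> nat \<Rightarrow> nat \<Rightarrow> int poly" where
  "gen_coeff n k \<delta> d i j =
     (if d \<le> column_degree k \<delta> j then Polynomial.monom 1 (nat ((int (n * d + i) - int j)\<^sup>2)) else 0)"

definition gen_mat :: "nat \<Rightarrow> nat \<Rightarrow> nat \<Rightarrow> int poly poly mat" where
  "gen_mat n k \<delta> = mat n k (\<lambda>(i, j). \<Sum>d\<le>column_degree k \<delta> j. Polynomial.monom (gen_coeff n k \<delta> d i j) d)"

lemma gen_mat_carrier [simp]: "gen_mat n k \<delta> \<in> carrier_mat n k"
  "dim_row (gen_mat n k \<delta>) = n" "dim_col (gen_mat n k \<delta>) = k"
  by (simp_all add: gen_mat_def)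

lemma coeff_gen_mat:
  assumes "i < n" "j < k"
  shows "Polynomial.coeff (gen_mat n k \<delta> $$ (i, j)) d = gen_coeff n k \<delta> d i j"
  using assms by (simp add: gen_mat_def Polynomial.coeff_sum) (simp add: gen_coeff_def)

lemma gen_coeff_eq_0: "column_degree k \<delta> j < d \<Longrightarrow> gen_coeff n k \<delta> d i j = 0"
  by (simp add: gen_coeff_def)

lemma degree_gen_mat:
  assumes "i < n" "j < k"
  shows "degree (gen_mat n k \<delta> $$ (i, j)) \<le> column_degree k \<delta> j"
  by (intro degree_le) (simp add: coeff_gen_mat[OF assms] gen_coeff_def)

lemma sum_column_degree:
  assumes "0 < k"
  shows "(\<Sum>j\<in>{0..<k}. column_degree k \<delta> j) = \<delta>"
proof -
  have "{0..<k} \<inter> {j. k - \<delta> mod k \<le> j} = {k - \<delta> mod k..<k}" by auto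
  then have "(\<Sum>j\<in>{0..<k}. if k - \<delta> mod k \<le> j then 1 else 0) = \<delta> mod k"
    using assms by (simp add: sum.If_cases less_imp_le)
  then show ?thesis by (simp add: column_degree_def sum.distrib)
qed

lemma mixed_radix_strict_mono:
  fixes n k q q' :: nat
  assumes "0 < k" "k \<le> n" "q < q'"
  shows "n * (q div k) + q mod k < n * (q' div k) + q' mod k"
proof (cases "q div k = q' div k")
  case True
  moreover have "q mod k < q' mod k"
  proof -
    have "q div k * k + q mod k = q" "q' div k * k + q' mod k = q'" by (rule div_mult_mod_eq)+
    moreover have "q div k * k = q' div k * k" using True by simp
    ultimately show ?thesis using assms(3) by linarith
  qed
  ultimately show ?thesis by simp
next
  case False
  then have "q div k + 1 \<le> q' div k" using div_le_mono[of q q' k] assms(3) by simp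
  then have "n * (q div k + 1) \<le> n * (q' div k)" by (rule mult_le_mono2)
  moreover have "q mod k < n" using mod_less_divisor[OF assms(1), of q] assms(2) by simp
  ultimately show ?thesis by simp
qed

text \<open>A square submatrix of the sliding generator matrix.  Column \<open>q\<close> belongs to the component \<open>q mod k\<close> of the
message vector at time \<open>q div k\<close>; row \<open>p\<close> belongs to the component \<open>f p mod n\<close> of the code vector at
time \<open>f p div n\<close>.\<close>

definition window_matrix :: "nat \<Rightarrow> nat \<Rightarrow> nat \<Rightarrow> nat \<Rightarrow> (nat \<Rightarrow> nat) \<Rightarrow> int poly mat" where
  "window_matrix n k \<delta> m f = mat m m (\<lambda>(p, q).
     if q div k \<le> f p div n then gen_coeff n k \<delta> (f p div n - q div k) (f p mod n) (q mod k) else 0)"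

text \<open>The hypotheses on \<open>f\<close> say that the diagonal entries are nonzero: the time of row \<open>p\<close> is not before the
time of column \<open>p\<close>, and it is not so late that the column has no coefficient left.  As the columns of
higher degree come last in each block, the second condition is linear in \<open>p\<close>.\<close>

lemma det_window_matrix:
  assumes k: "0 < k" "k < n" and f: "strict_mono_on {0..<m} f"
    and lo: "\<And>p. p < m \<Longrightarrow> k * (f p div n) \<le> p + \<delta>"
    and hi: "\<And>p. p < m \<Longrightarrow> p < k * (f p div n + 1)"
  shows "\<exists>e. \<bar>Polynomial.coeff (det (window_matrix n k \<delta> m f)) e\<bar> = 1"
proof (rule det_square_distance_powers[where m = m and \<pi> = id and \<rho> = "\<lambda>p. int (f p)" and
      \<kappa> = "\<lambda>q. int (n * (q div k) + q mod k)" and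
      S = "\<lambda>p q. q div k \<le> f p div n \<and> f p div n - q div k \<le> column_degree k \<delta> (q mod k)"])
  show "window_matrix n k \<delta> m f \<in> carrier_mat m m" by (simp add: window_matrix_def)
  show "id permutes {0..<m}" by (rule permutes_id)
  show "strict_mono_on {0..<m} (\<lambda>p. int (f p))"
    using f by (auto simp: strict_mono_on_def)
  show "strict_mono_on {0..<m} ((\<lambda>q. int (n * (q div k) + q mod k)) \<circ> id)"
    using mixed_radix_strict_mono[of k n] k by (auto simp: strict_mono_on_def simp del: of_nat_mult of_nat_add)
  fix p q assume pq: "p < m" "q < m"
  have "int (n * (f p div n - q div k) + f p mod n) - int (q mod k) =
      int (f p) - int (n * (q div k) + q mod k)" if "q div k \<le> f p div n"
  proof -
    have "n * (f p div n - q div k) + f p mod n + n * (q div k) = f p"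
    proof -
      have "n * (f p div n - q div k) + n * (q div k) = n * (f p div n)"
        using that by (simp flip: distrib_left)
      moreover have "n * (f p div n) + f p mod n = f p" by simp
      ultimately show ?thesis by linarith
    qed
    then show ?thesis by linarith
  qed
  then show "window_matrix n k \<delta> m f $$ (p, q) =
    (if q div k \<le> f p div n \<and> f p div n - q div k \<le> column_degree k \<delta> (q mod k)
     then Polynomial.monom 1 (nat ((int (f p) - int (n * (q div k) + q mod k))\<^sup>2)) else 0)"
    using pq by (simp add: window_matrix_def gen_coeff_def del: of_nat_add of_nat_mult of_nat_diff)
next
  fix p assume p: "p < m"
  let ?t = "f p div n" let ?\<tau> = "p div k" let ?j = "p mod k" let ?a = "\<delta> div k" let ?b = "\<delta> mod k"
  have b: "?b < k" and j: "?j < k" using k by auto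
  have p_eq: "p = k * ?\<tau> + ?j" and \<delta>_eq: "\<delta> = k * ?a + ?b" by simp_all
  have 1: "?\<tau> \<le> ?t" using hi[OF p] k(1) by (simp add: less_mult_imp_div_less mult.commute flip: less_Suc_eq_le)
  have 2: "?t - ?\<tau> \<le> column_degree k \<delta> ?j"
  proof (rule ccontr)
    assume "\<not> ?thesis"
    then have gt: "?t > ?\<tau> + column_degree k \<delta> ?j" by simp
    have le: "k * ?t \<le> k * (?\<tau> + ?a) + ?j + ?b"
      using lo[OF p] p_eq \<delta>_eq by (simp add: distrib_left)
    show False
    proof (cases "k - ?b \<le> ?j")
      case True
      then have "?t \<ge> ?\<tau> + ?a + 2" using gt by (simp add: column_degree_def)
      then have "k * (?\<tau> + ?a + 2) \<le> k * ?t" by (rule mult_le_mono2)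
      then show False using le b j unfolding distrib_left by linarith
    next
      case False
      then have "?t \<ge> ?\<tau> + ?a + 1" using gt by (simp add: column_degree_def)
      then have "k * (?\<tau> + ?a + 1) \<le> k * ?t" by (rule mult_le_mono2)
      then show False using le False unfolding distrib_left by linarith
    qed
  qed
  show "id p div k \<le> f p div n \<and> f p div n - id p div k \<le> column_degree k \<delta> (id p mod k)"
    using 1 2 by simp
qed

text \<open>Its rows are the coefficients of \<open>s\<^sup>t\<close> times a row of the generator matrix, for \<open>k + 1\<close> rows of the generator
matrix at each \<open>t < \<delta>\<close> and \<open>k\<close> rows at \<open>t = \<delta>\<close>; column \<open>q\<close> belongs to the coefficient of \<open>s\<^bsup>q div k\<^esup>\<close>.
These products have \<open>k * (\<delta> + 1) + \<delta>\<close> coefficients, which is also the number of rows.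
Components are listed in descending order, because with time running forward in the columns this
makes both weights increase.\<close>

definition bezout_matrix :: "nat \<Rightarrow> nat \<Rightarrow> nat \<Rightarrow> int poly mat" where
  "bezout_matrix n k \<delta> = mat (k * (\<delta> + 1) + \<delta>) (k * (\<delta> + 1) + \<delta>) (\<lambda>(p, q).
     if p div (k + 1) \<le> q div k
     then gen_coeff n k \<delta> (q div k - p div (k + 1)) (k - p mod (k + 1)) (k - 1 - q mod k) else 0)"

lemma det_bezout_matrix:
  assumes k: "0 < k" "k < n"
  shows "\<exists>e. \<bar>Polynomial.coeff (det (bezout_matrix n k \<delta>)) e\<bar> = 1"
proof (rule det_square_distance_powers[where m = "k * (\<delta> + 1) + \<delta>" and \<pi> = id and
      \<rho> = "\<lambda>p. int (n * (p div (k + 1)) + p mod (k + 1)) - int k" and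
      \<kappa> = "\<lambda>q. int (n * (q div k) + q mod k) - int (k - 1)" and
      S = "\<lambda>p q. p div (k + 1) \<le> q div k \<and>
        q div k - p div (k + 1) \<le> column_degree k \<delta> (k - 1 - q mod k)"])
  let ?m = "k * (\<delta> + 1) + \<delta>"
  show "bezout_matrix n k \<delta> \<in> carrier_mat ?m ?m" by (simp add: bezout_matrix_def)
  show "id permutes {0..<?m}" by (rule permutes_id)
  show "strict_mono_on {0..<?m} (\<lambda>p. int (n * (p div (k + 1)) + p mod (k + 1)) - int k)"
    using mixed_radix_strict_mono[of "k + 1" n] k by (auto simp: strict_mono_on_def simp del: of_nat_mult of_nat_add)
  show "strict_mono_on {0..<?m} ((\<lambda>q. int (n * (q div k) + q mod k) - int (k - 1)) \<circ> id)"
    unfolding o_def id_def using k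
    by (intro strict_mono_onI diff_strict_right_mono) (simp only: of_nat_less_iff mixed_radix_strict_mono less_imp_le)
  fix p q assume pq: "p < ?m" "q < ?m"
  let ?t = "p div (k + 1)" let ?i = "p mod (k + 1)" let ?s = "q div k" let ?j = "q mod k"
  have "(int (n * (?s - ?t) + (k - ?i)) - int (k - 1 - ?j))\<^sup>2 =
      (int (n * ?t + ?i) - int k - (int (n * ?s + ?j) - int (k - 1)))\<^sup>2" if "?t \<le> ?s"
  proof -
    have "?i \<le> k" using mod_less_divisor[of "k + 1" p] by simp
    moreover have "?j \<le> k - 1" using mod_less_divisor[OF k(1), of q] by simp
    moreover have "n * (?s - ?t) + n * ?t = n * ?s"
      using that by (simp add: diff_mult_distrib2 mult_le_mono2)
    ultimately have "int (n * (?s - ?t) + (k - ?i)) - int (k - 1 - ?j) =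
      - (int (n * ?t + ?i) - int k - (int (n * ?s + ?j) - int (k - 1)))" by linarith
    then show ?thesis by (simp only: power2_minus)
  qed
  then show "bezout_matrix n k \<delta> $$ (p, q) = (if ?t \<le> ?s \<and> ?s - ?t \<le> column_degree k \<delta> (k - 1 - ?j)
     then Polynomial.monom 1 (nat ((int (n * ?t + ?i) - int k - (int (n * ?s + ?j) - int (k - 1)))\<^sup>2)) else 0)"
    using pq by (simp add: bezout_matrix_def gen_coeff_def del: of_nat_add of_nat_mult of_nat_diff)
next
  let ?m = "k * (\<delta> + 1) + \<delta>"
  fix p assume p: "p < ?m"
  let ?t = "p div (k + 1)" let ?i = "p mod (k + 1)" let ?s = "p div k" let ?j = "p mod k"
  let ?a = "\<delta> div k" let ?b = "\<delta> mod k"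
  have b: "?b < k" and j: "?j < k" and i: "?i \<le> k" using k mod_less_divisor[of "k + 1" p] by auto
  have p1: "p = k * ?t + ?t + ?i" by (metis add.commute add.left_commute add_mult_distrib div_mult_mod_eq mult.commute mult_1)
  have p2: "p = k * ?s + ?j" and \<delta>_eq: "\<delta> = k * ?a + ?b" by simp_all
  have 1: "?t \<le> ?s" by (rule div_le_mono2) (use k in auto)
  \<comment> \<open>The last block has only \<open>k\<close> rows, which saves the case of equality.\<close>
  have ti: "?t + ?i < k + \<delta>"
  proof (cases "?t < \<delta>")
    case True
    then show ?thesis using i by linarith
  next
    case False
    have "p < (k + 1) * (\<delta> + 1)" using p by simp
    then have "?t < \<delta> + 1" by (simp add: less_mult_imp_div_less mult.commute)
    then have "?t = \<delta>" using False by simp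
    then show ?thesis using p1 p by simp
  qed
  have 2: "?s - ?t \<le> column_degree k \<delta> (k - 1 - ?j)"
  proof (rule ccontr)
    assume "\<not> ?thesis"
    then have gt: "?s > ?t + column_degree k \<delta> (k - 1 - ?j)" by simp
    have le: "k * ?s + ?j < k * (?t + ?a) + k + ?b"
      using ti p1 p2 \<delta>_eq by (simp add: distrib_left)
    show False
    proof (cases "k - ?b \<le> k - 1 - ?j")
      case True
      then have "?s \<ge> ?t + ?a + 2" using gt by (simp add: column_degree_def)
      then have "k * (?t + ?a + 2) \<le> k * ?s" by (rule mult_le_mono2)
      then show False using le b j unfolding distrib_left by linarith
    next
      case False
      then have "?s \<ge> ?t + ?a + 1" using gt by (simp add: column_degree_def)
      then have "k * (?t + ?a + 1) \<le> k * ?s" by (rule mult_le_mono2)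
      then show False using le False j unfolding distrib_left by linarith
    qed
  qed
  show "?t \<le> id p div k \<and> id p div k - ?t \<le> column_degree k \<delta> (k - 1 - id p mod k)"
    using 1 2 by simp
qed

definition leading_matrix :: "nat \<Rightarrow> nat \<Rightarrow> nat \<Rightarrow> int poly mat" where
  "leading_matrix n k \<delta> = mat k k (\<lambda>(i, j). gen_coeff n k \<delta> (column_degree k \<delta> j) i j)"

text \<open>The weight of column \<open>j\<close> is \<open>j\<close> minus \<open>n\<close> times its degree, so the \<open>\<delta> mod k\<close> columns of higher degree
have to come first; \<open>\<pi>\<close> is this rotation.\<close>

lemma det_leading_matrix:
  assumes k: "0 < k" "k < n"
  shows "\<exists>e. \<bar>Polynomial.coeff (det (leading_matrix n k \<delta>)) e\<bar> = 1"
proof -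
  define b where "b = \<delta> mod k"
  have b: "b < k" using k by (simp add: b_def)
  define \<pi> where "\<pi> i = (if i < k then if i < b then k - b + i else i - b else i)" for i
  have "inj_on \<pi> {0..<k}" using b by (auto simp: inj_on_def \<pi>_def split: if_splits)
  moreover have "\<pi> ` {0..<k} \<subseteq> {0..<k}" using b by (auto simp: \<pi>_def)
  ultimately have bij: "bij_betw \<pi> {0..<k} {0..<k}"
    by (simp add: bij_betw_def endo_inj_surj)
  have \<pi>: "\<pi> permutes {0..<k}" by (rule bij_imp_permutes[OF bij]) (auto simp: \<pi>_def)
  show ?thesis
  proof (rule det_square_distance_powers[where m = k and \<pi> = \<pi> and \<rho> = int and
        \<kappa> = "\<lambda>j. int j - int (n * column_degree k \<delta> j)" and S = "\<lambda>i j. True"])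
    show "leading_matrix n k \<delta> \<in> carrier_mat k k" by (simp add: leading_matrix_def)
    show "\<pi> permutes {0..<k}" by fact
    show "strict_mono_on {0..<k} int" by (auto simp: strict_mono_on_def)
    have "\<pi> i + n * column_degree k \<delta> (\<pi> i') < \<pi> i' + n * column_degree k \<delta> (\<pi> i)"
      if "i < i'" "i' < k" for i i'
      using that b k by (auto simp: \<pi>_def column_degree_def b_def[symmetric] algebra_simps intro: diff_less_mono)
    then show "strict_mono_on {0..<k} ((\<lambda>j. int j - int (n * column_degree k \<delta> j)) \<circ> \<pi>)"
      by (auto simp: strict_mono_on_def) (smt (verit) of_nat_add of_nat_less_iff of_nat_mult)
    fix i j assume "i < k" "j < k"
    then show "leading_matrix n k \<delta> $$ (i, j) = (if True
      then Polynomial.monom 1 (nat ((int i - (int j - int (n * column_degree k \<delta> j)))\<^sup>2)) else 0)"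
      by (simp add: leading_matrix_def gen_coeff_def algebra_simps)
  qed simp
qed

text \<open>The adjugate of the Bezout matrix expresses \<open>det\<close> times each unit vector as a combination of shifted
rows of the generator matrix.  Collecting the shifts of each row gives the rows of \<open>X\<close>.\<close>

lemma gen_mat_left_inverse:
  assumes k: "0 < k" "k < n"
  shows "\<exists>X\<in>carrier_mat k n. X * gen_mat n k \<delta> = [:det (bezout_matrix n k \<delta>):] \<cdot>\<^sub>m 1\<^sub>m k"
proof -
  define N where "N = k * (\<delta> + 1) + \<delta>"
  define B where "B = bezout_matrix n k \<delta>"
  have B: "B \<in> carrier_mat N N" by (simp add: B_def N_def bezout_matrix_def)
  define Y where "Y = adj_mat B"
  have Y: "Y \<in> carrier_mat N N" "Y * B = det B \<cdot>\<^sub>m 1\<^sub>m N" using adj_mat[OF B] by (simp_all add: Y_def)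
  define t where "t p = p div (k + 1)" for p
  define r where "r p = k - p mod (k + 1)" for p
  define X where "X = mat k n (\<lambda>(j, i). \<Sum>p\<in>{0..<N}. if r p = i then Polynomial.monom (Y $$ (k - 1 - j, p)) (t p) else 0)"
  have r: "r p < n" for p using k by (simp add: r_def)
  have t: "t p \<le> \<delta>" if "p < N" for p
  proof -
    have "p < (k + 1) * (\<delta> + 1)" using that by (simp add: N_def)
    then have "p div (k + 1) < \<delta> + 1" by (simp add: less_mult_imp_div_less mult.commute)
    then show ?thesis by (simp add: t_def)
  qed
  have kN: "k \<le> N" by (simp add: N_def)
  have "X * gen_mat n k \<delta> = [:det B:] \<cdot>\<^sub>m 1\<^sub>m k"
  proof (rule eq_matI)
    fix j0 j assume "j0 < dim_row ([:det B:] \<cdot>\<^sub>m 1\<^sub>m k)" "j < dim_col ([:det B:] \<cdot>\<^sub>m 1\<^sub>m k)"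
    then have j: "j0 < k" "j < k" by auto
    let ?G = "gen_mat n k \<delta>" and ?q0 = "k - 1 - j0"
    have "(X * ?G) $$ (j0, j) = (\<Sum>i\<in>{0..<n}. X $$ (j0, i) * ?G $$ (i, j))"
      using j by (simp add: X_def scalar_prod_def)
    also have "\<dots> = (\<Sum>i\<in>{0..<n}. \<Sum>p\<in>{0..<N}. if r p = i then Polynomial.monom (Y $$ (?q0, p)) (t p) * ?G $$ (i, j) else 0)"
      using j by (intro sum.cong) (auto simp: X_def sum_distrib_right intro!: sum.cong)
    also have "\<dots> = (\<Sum>p\<in>{0..<N}. \<Sum>i\<in>{0..<n}. if r p = i then Polynomial.monom (Y $$ (?q0, p)) (t p) * ?G $$ (i, j) else 0)"
      by (rule sum.swap)
    also have "\<dots> = (\<Sum>p\<in>{0..<N}. Polynomial.monom (Y $$ (?q0, p)) (t p) * ?G $$ (r p, j))"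
      using r by (intro sum.cong) auto
    finally have XG: "(X * ?G) $$ (j0, j) = (\<Sum>p\<in>{0..<N}. Polynomial.monom (Y $$ (?q0, p)) (t p) * ?G $$ (r p, j))" .
    have "Polynomial.coeff ((X * ?G) $$ (j0, j)) s = Polynomial.coeff (([:det B:] \<cdot>\<^sub>m 1\<^sub>m k) $$ (j0, j)) s" for s
    proof -
      have c: "Polynomial.coeff ((X * ?G) $$ (j0, j)) s =
          (\<Sum>p\<in>{0..<N}. Y $$ (?q0, p) * (if t p \<le> s then gen_coeff n k \<delta> (s - t p) (r p) j else 0))"
        unfolding XG Polynomial.coeff_sum using j r
        by (intro sum.cong) (auto simp: coeff_monom_mult coeff_gen_mat)
      \<comment> \<open>The column of the Bezout matrix that belongs to the coefficient of \<open>s\<close> in component \<open>j\<close>; if it does not exist, the degrees are too small to reach it.\<close>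
      define q where "q = k * s + (k - 1 - j)"
      have dm: "(k * s + w) div k = s" "(k * s + w) mod k = w" if "w < k" for w using that by simp_all
      have "k - 1 - j < k" using k by simp
      from dm[OF this] have q: "q div k = s" "k - 1 - q mod k = j" using j by (simp_all add: q_def)
      show ?thesis
      proof (cases "q < N")
        case True
        have "Polynomial.coeff ((X * ?G) $$ (j0, j)) s = (\<Sum>p\<in>{0..<N}. Y $$ (?q0, p) * B $$ (p, q))"
          unfolding c using True q by (intro sum.cong) (auto simp: B_def bezout_matrix_def N_def t_def r_def)
        also have "\<dots> = (Y * B) $$ (?q0, q)"
          using Y(1) B True j kN by (simp add: scalar_prod_def)
        also have "\<dots> = (if ?q0 = q then det B else 0)" unfolding Y(2) using True j kN by simp
        also have "?q0 = q \<longleftrightarrow> s = 0 \<and> j = j0"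
        proof
          assume eq: "?q0 = q"
          then have "q < k" using j by simp
          then have "s = 0" using q(1) by simp
          then show "s = 0 \<and> j = j0" using eq j by (simp add: q_def)
        next
          assume "s = 0 \<and> j = j0"
          then show "?q0 = q" by (simp add: q_def)
        qed
        finally show ?thesis using j by (auto simp: coeff_pCons split: nat.splits)
      next
        case False
        let ?a = "\<delta> div k" and ?b = "\<delta> mod k"
        have N_eq: "N = k * (\<delta> + 1 + ?a) + ?b"
          unfolding N_def by (simp add: distrib_left)
        have gt: "\<delta> + column_degree k \<delta> j < s"
        proof (rule ccontr)
          assume "\<not> ?thesis"
          then have le: "s \<le> \<delta> + column_degree k \<delta> j" by simp
          show False
          proof (cases "k - ?b \<le> j")
            case True
            then have "s \<le> \<delta> + 1 + ?a" using le by (simp add: column_degree_def)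
            then have "k * s \<le> k * (\<delta> + 1 + ?a)" by (rule mult_le_mono2)
            then show False using \<open>\<not> q < N\<close> True j unfolding q_def N_eq by linarith
          next
            case F: False
            then have "s \<le> \<delta> + ?a" using le by (simp add: column_degree_def)
            then have "k * (s + 1) \<le> k * (\<delta> + 1 + ?a)" by (intro mult_le_mono2) simp
            then show False using \<open>\<not> q < N\<close> j unfolding q_def N_eq distrib_left by linarith
          qed
        qed
        have "gen_coeff n k \<delta> (s - t p) (r p) j = 0" if "p < N" for p
          using gt t[OF that] by (intro gen_coeff_eq_0) simp
        then have "Polynomial.coeff ((X * ?G) $$ (j0, j)) s = 0" unfolding c by (intro sum.neutral) auto
        moreover have "s \<noteq> 0" using gt by simp
        ultimately show ?thesis using j by (auto simp: coeff_pCons split: nat.splits)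
      qed
    qed
    then show "(X * ?G) $$ (j0, j) = ([:det B:] \<cdot>\<^sub>m 1\<^sub>m k) $$ (j0, j)" by (rule poly_eqI)
  qed (auto simp: X_def)
  then show ?thesis by (intro bexI[of _ X]) (auto simp: X_def B_def)
qed

lemma degree_minor_gen_mat:
  assumes k: "0 < k" and I: "I \<subseteq> {..<n}" "card I = k"
  shows "degree (det (submatrix (gen_mat n k \<delta>) I UNIV)) \<le> \<delta>"
proof -
  let ?A = "submatrix (gen_mat n k \<delta>) I UNIV"
  have card: "{i. i < n \<and> i \<in> I} = I" using I by auto
  have A: "?A \<in> carrier_mat k k" using I by (intro carrier_matI) (simp_all add: dim_submatrix card)
  have deg: "degree (?A $$ (i, j)) \<le> column_degree k \<delta> j" if "i < k" "j < k" for i j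
  proof -
    have "pick I i < n" using pick_in_set_le[of i I] I that by auto
    then show ?thesis using that I degree_gen_mat by (subst submatrix_index) (auto simp: card pick_UNIV)
  qed
  have summand: "degree (\<Prod>i\<in>{0..<k}. ?A $$ (i, \<sigma> i)) \<le> \<delta>" if \<sigma>: "\<sigma> permutes {0..<k}" for \<sigma>
  proof -
    have "\<sigma> i < k" if "i < k" for i using permutes_in_image[OF \<sigma>, of i] that by simp
    then have "degree (\<Prod>i\<in>{0..<k}. ?A $$ (i, \<sigma> i)) \<le> (\<Sum>i\<in>{0..<k}. column_degree k \<delta> (\<sigma> i))"
      using deg by (intro order_trans[OF degree_prod_sum_le] sum_mono) auto
    also have "\<dots> = (\<Sum>i\<in>{0..<k}. column_degree k \<delta> i)"
      using sum.permute[OF \<sigma>, of "column_degree k \<delta>"] by (simp add: o_def)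
    finally show ?thesis using sum_column_degree[OF k] by simp
  qed
  show ?thesis
    unfolding det_def'[OF A]
  proof (intro degree_sum_le)
    fix \<sigma> assume "\<sigma> \<in> {\<sigma>. \<sigma> permutes {0..<k}}"
    then show "degree (signof \<sigma> * (\<Prod>i = 0..<k. ?A $$ (i, \<sigma> i))) \<le> \<delta>"
      using summand[of \<sigma>] by (auto simp: sign_def)
  qed (simp add: finite_permutations)
qed

lemma coeff_mult_at_degree_bound:
  fixes f g :: "'a::comm_semiring_0 poly"
  assumes "degree f \<le> a" "degree g \<le> b"
  shows "Polynomial.coeff (f * g) (a + b) = Polynomial.coeff f a * Polynomial.coeff g b"
proof -
  have "Polynomial.coeff f i * Polynomial.coeff g (a + b - i) = 0" if "i \<le> a + b" "i \<noteq> a" for i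
  proof (cases "i < a")
    case True
    then show ?thesis using assms(2) by (simp add: coeff_eq_0)
  next
    case False
    then show ?thesis using that assms(1) by (simp add: coeff_eq_0)
  qed
  then have "(\<Sum>i\<le>a + b. Polynomial.coeff f i * Polynomial.coeff g (a + b - i)) =
      (\<Sum>i\<in>{a}. Polynomial.coeff f i * Polynomial.coeff g (a + b - i))"
    by (intro sum.mono_neutral_right) auto
  then show ?thesis by (simp add: coeff_mult)
qed

lemma coeff_prod_at_degree_bound:
  assumes "finite I" "\<And>i. i \<in> I \<Longrightarrow> degree (g i) \<le> (d i :: nat)"
  shows "Polynomial.coeff (\<Prod>i\<in>I. g i) (\<Sum>i\<in>I. d i) = (\<Prod>i\<in>I. Polynomial.coeff (g i) (d i))"
  using assms
proof (induction I rule: finite_induct)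
  case (insert i I)
  have "degree (\<Prod>i\<in>I. g i) \<le> (\<Sum>i\<in>I. d i)"
    using insert.prems by (intro order_trans[OF degree_prod_sum_le[OF insert.hyps(1)]] sum_mono) auto
  then have "Polynomial.coeff (g i * (\<Prod>i\<in>I. g i)) (d i + (\<Sum>i\<in>I. d i)) =
      Polynomial.coeff (g i) (d i) * Polynomial.coeff (\<Prod>i\<in>I. g i) (\<Sum>i\<in>I. d i)"
    using insert.prems by (intro coeff_mult_at_degree_bound) auto
  then show ?case using insert by simp
qed simp

text \<open>In each term of the Leibniz formula the bounds on the degrees of the factors add up to \<open>\<delta>\<close>.\<close>

lemma coeff_leading_minor:
  assumes k: "0 < k" "k < n"
  shows "Polynomial.coeff (det (submatrix (gen_mat n k \<delta>) {..<k} UNIV)) \<delta> = det (leading_matrix n k \<delta>)"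
proof -
  let ?A = "submatrix (gen_mat n k \<delta>) {..<k} UNIV" and ?B = "leading_matrix n k \<delta>"
  have card: "{i. i < n \<and> i \<in> {..<k}} = {..<k}" using k by auto
  have A: "?A \<in> carrier_mat k k" by (intro carrier_matI) (simp_all add: dim_submatrix card del: lessThan_iff)
  have B: "?B \<in> carrier_mat k k" by (simp add: leading_matrix_def)
  have entry: "?A $$ (i, j) = gen_mat n k \<delta> $$ (i, j)" if "i < k" "j < k" for i j
  proof -
    have "pick {..<k} i = i"
    proof -
      have "{a \<in> {..<k}. a < i} = {..<i}" using that by auto
      then show ?thesis using pick_card_in_set[of i "{..<k}"] that by simp
    qed
    then show ?thesis using that by (subst submatrix_index) (simp_all add: card pick_UNIV del: lessThan_iff)
  qed
  show ?thesis
    unfolding det_def'[OF A] det_def'[OF B] Polynomial.coeff_sum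
  proof (rule sum.cong[OF refl])
    fix \<sigma> assume "\<sigma> \<in> {\<sigma>. \<sigma> permutes {0..<k}}"
    then have \<sigma>: "\<sigma> permutes {0..<k}" by simp
    have \<sigma>k: "\<sigma> i < k" if "i < k" for i using permutes_in_image[OF \<sigma>, of i] that by simp
    have "(\<Sum>i\<in>{0..<k}. column_degree k \<delta> (\<sigma> i)) = \<delta>"
      using sum.permute[OF \<sigma>, of "column_degree k \<delta>"] sum_column_degree[OF k(1)] by (simp add: o_def)
    moreover have "Polynomial.coeff (\<Prod>i\<in>{0..<k}. ?A $$ (i, \<sigma> i)) (\<Sum>i\<in>{0..<k}. column_degree k \<delta> (\<sigma> i)) =
        (\<Prod>i\<in>{0..<k}. Polynomial.coeff (?A $$ (i, \<sigma> i)) (column_degree k \<delta> (\<sigma> i)))"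
      using k by (intro coeff_prod_at_degree_bound) (auto simp: entry \<sigma>k intro!: degree_gen_mat)
    moreover have "(\<Prod>i\<in>{0..<k}. Polynomial.coeff (?A $$ (i, \<sigma> i)) (column_degree k \<delta> (\<sigma> i))) =
        (\<Prod>i\<in>{0..<k}. ?B $$ (i, \<sigma> i))"
      using k by (intro prod.cong) (auto simp: entry \<sigma>k coeff_gen_mat leading_matrix_def)
    ultimately have "Polynomial.coeff (\<Prod>i\<in>{0..<k}. ?A $$ (i, \<sigma> i)) \<delta> = (\<Prod>i\<in>{0..<k}. ?B $$ (i, \<sigma> i))" by simp
    then show "Polynomial.coeff (signof \<sigma> * (\<Prod>i\<in>{0..<k}. ?A $$ (i, \<sigma> i))) \<delta> = signof \<sigma> * (\<Prod>i\<in>{0..<k}. ?B $$ (i, \<sigma> i))"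
      by (auto simp: sign_def)
  qed
qed

section \<open>Evaluation in a finite field\<close>

lemma finite_square_matrices:
  assumes "finite E"
  shows "finite {A. \<exists>m\<le>N. A \<in> carrier_mat m m \<and> (\<forall>i<m. \<forall>j<m. A $$ (i, j) \<in> E)}" (is "finite ?M")
proof (rule finite_subset)
  let ?I = "\<lambda>m. {..<m} \<times> {..<m :: nat}"
  show "?M \<subseteq> (\<Union>m\<le>N. mat m m ` PiE (?I m) (\<lambda>_. E))"
  proof
    fix A assume "A \<in> ?M"
    then obtain m where m: "m \<le> N" "A \<in> carrier_mat m m" "\<forall>i<m. \<forall>j<m. A $$ (i, j) \<in> E" by auto
    have "A = mat m m (restrict (\<lambda>(i, j). A $$ (i, j)) (?I m))"
      using m(2) by (intro eq_matI) auto
    moreover have "restrict (\<lambda>(i, j). A $$ (i, j)) (?I m) \<in> PiE (?I m) (\<lambda>_. E)"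
      using m(3) by auto
    ultimately show "A \<in> (\<Union>m\<le>N. mat m m ` PiE (?I m) (\<lambda>_. E))" using m(1) by blast
  qed
  show "finite (\<Union>m\<le>N. mat m m ` PiE (?I m) (\<lambda>_. E))"
    using assms by (intro finite_UN_I finite_imageI finite_PiE) auto
qed

text \<open>The size bound \<open>k * (2 * \<delta> + 1)\<close> covers windows up to the time \<open>2 * \<delta>\<close>, and both \<open>L\<close> and \<open>M\<close> are at most
\<open>2 * \<delta>\<close>.\<close>

locale generic_evaluation = onto_ring_hom F h + field F
  for F :: "('a, 'b) ring_scheme" and h :: "int poly \<Rightarrow> 'a" +
  fixes n k \<delta> :: nat
  assumes k_pos: "0 < k" and k_less: "k < n"
    and det_nonzero: "\<lbrakk>m \<le> k * (2 * \<delta> + 1); A \<in> carrier_mat m m;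
      \<And>i j. i < m \<Longrightarrow> j < m \<Longrightarrow> A $$ (i, j) = 0 \<or> (\<exists>d. \<exists>i'<n. \<exists>j'<k. A $$ (i, j) = gen_coeff n k \<delta> d i' j');
      \<exists>e. \<bar>Polynomial.coeff (det A) e\<bar> = 1\<rbrakk> \<Longrightarrow> h (det A) \<noteq> \<zero>\<^bsub>F\<^esub>"

text \<open>There are finitely many matrices of bounded size whose entries are coefficients of the generator
matrix or zero, so one field serves all of them.\<close>

lemma generic_evaluation_exists:
  assumes "0 < k" "k < n" "prime p"
  shows "\<exists>(F :: nat ring) h. generic_evaluation F h n k \<delta> \<and> finite (carrier F) \<and> ring_characteristic F = p"
proof -
  define E where "E = insert 0 ((\<lambda>(d, i, j). gen_coeff n k \<delta> d i j) ` ({..\<delta> div k + 1} \<times> {..<n} \<times> {..<k}))"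
  have "finite E" by (simp add: E_def)
  define Ms where "Ms = {A :: int poly mat. \<exists>m\<le>k * (2 * \<delta> + 1). A \<in> carrier_mat m m \<and> (\<forall>i<m. \<forall>j<m. A $$ (i, j) \<in> E)}"
  define S where "S = det ` {A \<in> Ms. \<exists>e. \<bar>Polynomial.coeff (det A) e\<bar> = 1}"
  have "finite S" unfolding S_def Ms_def using finite_square_matrices[OF \<open>finite E\<close>] by simp
  moreover have "\<not> [:int p:] dvd f" if "f \<in> S" for f
  proof
    assume "[:int p:] dvd f"
    then have "int p dvd Polynomial.coeff f e" for e by (simp add: const_poly_dvd_iff)
    moreover obtain e where "\<bar>Polynomial.coeff f e\<bar> = 1" using \<open>f \<in> S\<close> by (auto simp: S_def)
    ultimately have "int p dvd 1" by (metis dvd_abs_iff)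
    then show False using assms(3) by (simp add: prime_nat_iff)
  qed
  ultimately obtain F :: "nat ring" and h where F: "field F" "finite (carrier F)" "ring_characteristic F = p"
    "onto_ring_hom F h" and S: "\<And>f. f \<in> S \<Longrightarrow> h f \<noteq> \<zero>\<^bsub>F\<^esub>"
    using finite_field_avoiding_roots[OF assms(3)] by metis
  have "generic_evaluation F h n k \<delta>"
  proof (intro generic_evaluation.intro generic_evaluation_axioms.intro F assms(1,2))
    fix m and A :: "int poly mat"
    assume A: "m \<le> k * (2 * \<delta> + 1)" "A \<in> carrier_mat m m" "\<exists>e. \<bar>Polynomial.coeff (det A) e\<bar> = 1"
      and ent: "\<And>i j. i < m \<Longrightarrow> j < m \<Longrightarrow> A $$ (i, j) = 0 \<or> (\<exists>d. \<exists>i'<n. \<exists>j'<k. A $$ (i, j) = gen_coeff n k \<delta> d i' j')"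
    have "A $$ (i, j) \<in> E" if ij: "i < m" "j < m" for i j
    proof (cases "A $$ (i, j) = 0")
      case True
      then show ?thesis by (simp add: E_def)
    next
      case False
      then obtain d i' j' where e: "A $$ (i, j) = gen_coeff n k \<delta> d i' j'" "i' < n" "j' < k"
        using ent[OF ij] by blast
      have "d \<le> column_degree k \<delta> j'" using e(1) False gen_coeff_eq_0 by (metis not_le)
      then have "d \<le> \<delta> div k + 1" by (simp add: column_degree_def split: if_splits)
      then show ?thesis unfolding E_def e(1) using e(2,3)
        by (intro insertI2 image_eqI[of _ _ "(d, i', j')"]) auto
    qed
    then have "A \<in> Ms" using A(1,2) unfolding Ms_def by blast
    then show "h (det A) \<noteq> \<zero>\<^bsub>F\<^esub>" using A(3) by (intro S) (auto simp: S_def)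
  qed
  then show ?thesis using F by blast
qed

context generic_evaluation
begin

lemma window_det_nonzero:
  assumes m: "m \<le> k * (2 * \<delta> + 1)" and f: "strict_mono_on {0..<m} f"
    and lo: "\<And>p. p < m \<Longrightarrow> k * (f p div n) \<le> p + \<delta>"
    and hi: "\<And>p. p < m \<Longrightarrow> p < k * (f p div n + 1)"
  shows "h (det (window_matrix n k \<delta> m f)) \<noteq> \<zero>\<^bsub>F\<^esub>"
proof (rule det_nonzero[OF m])
  show "window_matrix n k \<delta> m f \<in> carrier_mat m m" by (simp add: window_matrix_def)
  show "\<exists>e. \<bar>Polynomial.coeff (det (window_matrix n k \<delta> m f)) e\<bar> = 1"
    using k_pos k_less f lo hi by (rule det_window_matrix)
  fix i j assume ij: "i < m" "j < m"
  have "f i mod n < n" "j mod k < k" using k_pos k_less by auto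
  then show "window_matrix n k \<delta> m f $$ (i, j) = 0 \<or>
    (\<exists>d. \<exists>i'<n. \<exists>j'<k. window_matrix n k \<delta> m f $$ (i, j) = gen_coeff n k \<delta> d i' j')"
    using ij by (auto simp: window_matrix_def)
qed

lemma bezout_det_nonzero: "h (det (bezout_matrix n k \<delta>)) \<noteq> \<zero>\<^bsub>F\<^esub>"
proof (rule det_nonzero)
  let ?m = "k * (\<delta> + 1) + \<delta>"
  have "\<delta> \<le> k * \<delta>" using k_pos by simp
  then show "?m \<le> k * (2 * \<delta> + 1)" by (simp add: distrib_left)
  show "bezout_matrix n k \<delta> \<in> carrier_mat ?m ?m" by (simp add: bezout_matrix_def)
  show "\<exists>e. \<bar>Polynomial.coeff (det (bezout_matrix n k \<delta>)) e\<bar> = 1"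
    using k_pos k_less by (rule det_bezout_matrix)
  fix i j assume ij: "i < ?m" "j < ?m"
  have "k - i mod (k + 1) < n" "k - 1 - j mod k < k" using k_pos k_less by auto
  then show "bezout_matrix n k \<delta> $$ (i, j) = 0 \<or>
    (\<exists>d. \<exists>i'<n. \<exists>j'<k. bezout_matrix n k \<delta> $$ (i, j) = gen_coeff n k \<delta> d i' j')"
    using ij by (auto simp: bezout_matrix_def)
qed

lemma leading_det_nonzero: "h (det (leading_matrix n k \<delta>)) \<noteq> \<zero>\<^bsub>F\<^esub>"
proof (rule det_nonzero)
  show "k \<le> k * (2 * \<delta> + 1)" by simp
  show "leading_matrix n k \<delta> \<in> carrier_mat k k" by (simp add: leading_matrix_def)
  show "\<exists>e. \<bar>Polynomial.coeff (det (leading_matrix n k \<delta>)) e\<bar> = 1"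
    using k_pos k_less by (rule det_leading_matrix)
  fix i j assume ij: "i < k" "j < k"
  moreover have "i < n" using ij k_less by simp
  ultimately show "leading_matrix n k \<delta> $$ (i, j) = 0 \<or>
    (\<exists>d. \<exists>i'<n. \<exists>j'<k. leading_matrix n k \<delta> $$ (i, j) = gen_coeff n k \<delta> d i' j')"
    by (auto simp: leading_matrix_def)
qed

end

section \<open>Zeros of codewords\<close>

lemma sum_div_mod:
  fixes f :: "nat \<Rightarrow> nat \<Rightarrow> 'a::comm_monoid_add"
  shows "(\<Sum>q<k * T. f (q div k) (q mod k)) = (\<Sum>t<T. \<Sum>j<k. f t j)"
proof (cases "k = 0")
  case False
  have "(\<Sum>q<k * T. f (q div k) (q mod k)) = (\<Sum>t<T. \<Sum>q\<in>{t * k..<t * k + k}. f (q div k) (q mod k))"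
    using sum.nat_group[of "\<lambda>q. f (q div k) (q mod k)" k T] by (simp add: mult.commute)
  also have "\<dots> = (\<Sum>t<T. \<Sum>j<k. f t j)"
  proof (rule sum.cong[OF refl])
    fix t
    have "(\<Sum>q\<in>{t * k..<t * k + k}. f (q div k) (q mod k)) = (\<Sum>j\<in>{0..<k}. f ((j + t * k) div k) ((j + t * k) mod k))"
      using sum.shift_bounds_nat_ivl[of "\<lambda>q. f (q div k) (q mod k)" 0 "t * k" k] by (simp add: add.commute)
    also have "\<dots> = (\<Sum>j\<in>{0..<k}. f t j)" using False by (intro sum.cong) auto
    finally show "(\<Sum>q\<in>{t * k..<t * k + k}. f (q div k) (q mod k)) = (\<Sum>j<k. f t j)"
      by (simp add: atLeast0LessThan)
  qed
  finally show ?thesis .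
qed simp

text \<open>The set \<open>Z\<close> stands for zeros of a codeword at the positions \<open>n * t + i\<close>, and \<open>J'\<close> is the first time
up to which there are at least as many zeros as message symbols.  Minimality of \<open>J'\<close> gives the upper
bound for \<open>p\<close>.  For the lower bound, compare the number of zeros from the block of \<open>pick Z p\<close> onwards
with the total size \<open>n * (J' + 1 - t)\<close> of these blocks: if \<open>k * t > p + \<delta>\<close>, there would be more zeros than
places.  The surplus \<open>x\<close> of zeros is what makes this work for the last window if \<open>n - k\<close> does not
divide \<open>\<delta>\<close>; the first \<open>k * (J' + 1)\<close> zeros are selected, so that the surplus is dropped at the end.\<close>

lemma select_rows:
  fixes n k \<delta> J x :: nat
  assumes k: "0 < k" "k < n" and Z: "Z \<subseteq> {..<n * (J + 1)}" "k * (J + 1) + x \<le> card Z"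
    and J: "(n - k) * J \<le> (n - k) * (\<delta> div k) + \<delta> + x" and x: "x \<le> n - k"
  shows "\<exists>J'\<le>J. strict_mono_on {0..<k * (J' + 1)} (pick Z) \<and> (\<forall>p<k * (J' + 1).
    pick Z p \<in> Z \<and> pick Z p div n \<le> J' \<and> k * (pick Z p div n) \<le> p + \<delta> \<and> p < k * (pick Z p div n + 1))"
proof -
  have n: "0 < n" using k by simp
  have finZ: "finite Z" using Z(1) finite_subset by blast
  define \<zeta> where "\<zeta> j = card {a \<in> Z. a < n * (j + 1)}" for j
  have "{a \<in> Z. a < n * (J + 1)} = Z" using Z(1) by auto
  then have \<zeta>J: "\<zeta> J = card Z" by (simp add: \<zeta>_def)
  define J' where "J' = (LEAST j. k * (j + 1) \<le> \<zeta> j)"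
  have J'1: "k * (J' + 1) \<le> \<zeta> J'" unfolding J'_def by (rule LeastI[of _ J]) (use Z(2) \<zeta>J in simp)
  have J'2: "J' \<le> J" unfolding J'_def by (rule Least_le) (use Z(2) \<zeta>J in simp)
  have J'3: "\<zeta> j < k * (j + 1)" if "j < J'" for j
    using not_less_Least[of j "\<lambda>j. k * (j + 1) \<le> \<zeta> j"] that unfolding J'_def by simp
  have \<zeta>le: "\<zeta> J' \<le> card Z" unfolding \<zeta>_def by (intro card_mono finZ) auto
  have "pick Z p \<in> Z \<and> pick Z p div n \<le> J' \<and> k * (pick Z p div n) \<le> p + \<delta> \<and> p < k * (pick Z p div n + 1)"
    if p: "p < k * (J' + 1)" for p
  proof -
    define P where "P = pick Z p"
    define t where "t = P div n"
    have pZ: "p < card Z" using p J'1 \<zeta>le by linarith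
    have PZ: "P \<in> Z" unfolding P_def by (rule pick_in_set_le[OF pZ])
    have cP: "card {a \<in> Z. a < P} = p" unfolding P_def by (rule card_pick_le[OF pZ])
    have PJ: "P < n * (J' + 1)"
    proof (rule ccontr)
      assume "\<not> P < n * (J' + 1)"
      then have "{a \<in> Z. a < n * (J' + 1)} \<subseteq> {a \<in> Z. a < P}" by auto
      then have "\<zeta> J' \<le> p" unfolding \<zeta>_def cP[symmetric] using finZ by (intro card_mono) auto
      then show False using p J'1 by simp
    qed
    have tJ: "t \<le> J'"
      using PJ by (simp add: t_def less_mult_imp_div_less mult.commute flip: less_Suc_eq_le)
    have "n * t + P mod n = P" "P mod n < n" using n by (simp_all add: t_def)
    then have tP: "n * t \<le> P" "P < n * (t + 1)" unfolding distrib_left by linarith+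
    have hi: "p < k * (t + 1)"
    proof (cases "t = J'")
      case False
      have "insert P {a \<in> Z. a < P} \<subseteq> {a \<in> Z. a < n * (t + 1)}" using PZ tP by auto
      then have "card (insert P {a \<in> Z. a < P}) \<le> \<zeta> t" unfolding \<zeta>_def using finZ by (intro card_mono) auto
      then have "p + 1 \<le> \<zeta> t" using cP finZ by simp
      then show ?thesis using J'3[of t] tJ False by simp
    qed (use p in simp)
    have lo: "k * t \<le> p + \<delta>"
    proof (rule ccontr)
      assume "\<not> ?thesis"
      then have gt: "p + \<delta> < k * t" by simp
      obtain D where D: "J' + 1 = t + D" "D \<ge> 1" using tJ by (metis add.assoc le_add2 le_iff_add)
      obtain r where r: "n = k + r" using k(2) less_imp_add_positive by blast
      have "{a \<in> Z. a < n * (J' + 1)} \<subseteq> {a \<in> Z. a < P} \<union> {n * t..<n * (J' + 1)}" using tP by auto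
      then have "\<zeta> J' \<le> card ({a \<in> Z. a < P} \<union> {n * t..<n * (J' + 1)})"
        unfolding \<zeta>_def using finZ by (intro card_mono) auto
      also have "\<dots> \<le> p + n * D"
        using card_Un_le[of "{a \<in> Z. a < P}" "{n * t..<n * (J' + 1)}"] cP by (simp only: D card_atLeastLessThan distrib_left)
      finally have c: "\<zeta> J' \<le> p + k * D + r * D" by (simp add: r distrib_right)
      have "k * (\<delta> div k) \<le> \<delta>" by simp
      then have "k * (\<delta> div k) < k * t" using gt by linarith
      then have "\<delta> div k < t" by simp
      then have DJ: "D + \<delta> div k \<le> J'" using D by linarith
      show False
      proof (cases "J' = J")
        case True
        have "k * (J' + 1) + x \<le> \<zeta> J'" using True \<zeta>J Z(2) by simp
        then have "k * t + k * D + x \<le> p + k * D + r * D" using c by (simp only: D distrib_left)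
        then have 1: "\<delta> + x < r * D" using gt by linarith
        have "r * (D + \<delta> div k) \<le> r * J" using DJ True by (intro mult_le_mono2) simp
        then have "r * D + r * (\<delta> div k) \<le> r * (\<delta> div k) + \<delta> + x" using J by (simp add: r distrib_left)
        then show False using 1 by simp
      next
        case False
        have "k * t + k * D \<le> p + k * D + r * D" using c J'1 by (simp only: D distrib_left)
        then have 1: "\<delta> < r * D" using gt by linarith
        have "r * (D + \<delta> div k + 1) \<le> r * J" using DJ False J'2 by (intro mult_le_mono2) simp
        then have "r * D + r * (\<delta> div k) + r \<le> r * (\<delta> div k) + \<delta> + x" using J by (simp add: r distrib_left)
        then show False using 1 x by (simp add: r)
      qed
    qed
    show ?thesis using PZ tJ lo hi unfolding t_def P_def by simp
  qed
  moreover have "strict_mono_on {0..<k * (J' + 1)} (pick Z)"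
  proof (rule strict_mono_onI)
    fix p q assume "p \<in> {0..<k * (J' + 1)}" "q \<in> {0..<k * (J' + 1)}" "p < q"
    then show "pick Z p < pick Z q" using J'1 \<zeta>le by (intro pick_mono_le) auto
  qed
  ultimately show ?thesis using J'2 by blast
qed

lemma coeff_gen_mat_mult:
  assumes k: "0 < k" and u: "u \<in> carrier_vec k" and i: "i < n" and t: "t < T"
  shows "Polynomial.coeff ((gen_mat n k \<delta> *\<^sub>v u) $ i) t =
    (\<Sum>q<k * T. if q div k \<le> t then gen_coeff n k \<delta> (t - q div k) i (q mod k) * Polynomial.coeff (u $ (q mod k)) (q div k) else 0)"
proof -
  have "Polynomial.coeff ((gen_mat n k \<delta> *\<^sub>v u) $ i) t =
      (\<Sum>j<k. Polynomial.coeff (u $ j * gen_mat n k \<delta> $$ (i, j)) t)"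
    using u i by (simp add: scalar_prod_def Polynomial.coeff_sum mult.commute atLeast0LessThan)
  also have "\<dots> = (\<Sum>j<k. \<Sum>\<tau>\<le>t. Polynomial.coeff (u $ j) \<tau> * gen_coeff n k \<delta> (t - \<tau>) i j)"
    using i by (intro sum.cong) (auto simp: coeff_mult coeff_gen_mat)
  also have "\<dots> = (\<Sum>\<tau>\<le>t. \<Sum>j<k. Polynomial.coeff (u $ j) \<tau> * gen_coeff n k \<delta> (t - \<tau>) i j)"
    by (rule sum.swap)
  also have "\<dots> = (\<Sum>\<tau><T. \<Sum>j<k. if \<tau> \<le> t then gen_coeff n k \<delta> (t - \<tau>) i j * Polynomial.coeff (u $ j) \<tau> else 0)"
    using t by (intro sum.mono_neutral_cong_left) (auto simp: mult.commute)
  finally show ?thesis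
    using sum_div_mod[of "\<lambda>\<tau> j. if \<tau> \<le> t then gen_coeff n k \<delta> (t - \<tau>) i j * Polynomial.coeff (u $ j) \<tau> else 0" k T]
    by simp
qed

lemma window_matrix_mult:
  assumes k: "0 < k" "k < n" and u: "u \<in> carrier_vec k" and p: "p < m" "f p div n < T" and m: "m \<le> k * T"
    and sup: "\<And>q. m \<le> q \<Longrightarrow> q < k * T \<Longrightarrow> Polynomial.coeff (u $ (q mod k)) (q div k) = 0"
  shows "(window_matrix n k \<delta> m f *\<^sub>v vec m (\<lambda>q. Polynomial.coeff (u $ (q mod k)) (q div k))) $ p =
    Polynomial.coeff ((gen_mat n k \<delta> *\<^sub>v u) $ (f p mod n)) (f p div n)"
proof -
  have i: "f p mod n < n" using k by simp
  have "Polynomial.coeff ((gen_mat n k \<delta> *\<^sub>v u) $ (f p mod n)) (f p div n) =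
    (\<Sum>q<m. if q div k \<le> f p div n then gen_coeff n k \<delta> (f p div n - q div k) (f p mod n) (q mod k)
       * Polynomial.coeff (u $ (q mod k)) (q div k) else 0)"
    unfolding coeff_gen_mat_mult[OF k(1) u i p(2)]
    using m sup by (intro sum.mono_neutral_right) auto
  also have "\<dots> = (window_matrix n k \<delta> m f *\<^sub>v vec m (\<lambda>q. Polynomial.coeff (u $ (q mod k)) (q div k))) $ p"
    using p(1) by (auto simp: window_matrix_def scalar_prod_def atLeast0LessThan intro!: sum.cong)
  finally show ?thesis ..
qed

context generic_evaluation
begin

text \<open>The zeros say that the window matrix annihilates the message coefficients; multiply by its adjugate.\<close>

lemma window_zero:
  assumes m: "k * T \<le> k * (2 * \<delta> + 1)" and f: "strict_mono_on {0..<k * T} f"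
    and lo: "\<And>p. p < k * T \<Longrightarrow> k * (f p div n) \<le> p + \<delta>"
    and hi: "\<And>p. p < k * T \<Longrightarrow> p < k * (f p div n + 1)"
    and T: "\<And>p. p < k * T \<Longrightarrow> f p div n < T"
    and u: "u \<in> carrier_vec k"
    and zero: "\<And>p. p < k * T \<Longrightarrow> h (Polynomial.coeff ((gen_mat n k \<delta> *\<^sub>v u) $ (f p mod n)) (f p div n)) = \<zero>\<^bsub>F\<^esub>"
    and q: "q < k * T"
  shows "h (Polynomial.coeff (u $ (q mod k)) (q div k)) = \<zero>\<^bsub>F\<^esub>"
proof -
  let ?m = "k * T"
  define A where "A = window_matrix n k \<delta> ?m f"
  define U where "U = vec ?m (\<lambda>q. Polynomial.coeff (u $ (q mod k)) (q div k))"
  have A: "A \<in> carrier_mat ?m ?m" by (simp add: A_def window_matrix_def)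
  have U: "U \<in> carrier_vec ?m" by (simp add: U_def)
  have nz: "h (det A) \<noteq> \<zero>\<^bsub>F\<^esub>" unfolding A_def using m f lo hi by (rule window_det_nonzero)
  have AU: "map_vec h (A *\<^sub>v U) = map_vec h (0\<^sub>v ?m)"
  proof (rule eq_vecI)
    fix p assume "p < dim_vec (map_vec h (0\<^sub>v ?m))"
    then have p: "p < ?m" by simp
    have "(A *\<^sub>v U) $ p = Polynomial.coeff ((gen_mat n k \<delta> *\<^sub>v u) $ (f p mod n)) (f p div n)"
      unfolding A_def U_def by (rule window_matrix_mult[where f = f, OF k_pos k_less u p T[OF p]]) auto
    then show "map_vec h (A *\<^sub>v U) $ p = map_vec h (0\<^sub>v ?m) $ p"
      using zero[OF p] p A by (simp add: h_zero del: index_mult_mat_vec)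
  qed (use A in simp)
  note adj = adj_mat[OF A]
  have "(adj_mat A * A) *\<^sub>v U = adj_mat A *\<^sub>v (A *\<^sub>v U)"
    by (rule assoc_mult_mat_vec[OF adj(1) A U])
  also have "map_vec h \<dots> = map_vec h (adj_mat A *\<^sub>v 0\<^sub>v ?m)"
    using A U adj(1) AU by (intro map_mat_mult_vec_cong[OF adj(1) adj(1)]) auto
  also have "adj_mat A *\<^sub>v 0\<^sub>v ?m = 0\<^sub>v ?m" using adj(1) by auto
  finally have "map_vec h ((adj_mat A * A) *\<^sub>v U) $ q = map_vec h (0\<^sub>v ?m) $ q" by simp
  then have W0: "h (((adj_mat A * A) *\<^sub>v U) $ q) = \<zero>\<^bsub>F\<^esub>"
    using q adj(1) by (simp add: h_zero del: index_mult_mat_vec)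
  have Wq: "((adj_mat A * A) *\<^sub>v U) $ q = det A * U $ q"
  proof -
    have "((adj_mat A * A) *\<^sub>v U) $ q = (\<Sum>i\<in>{0..<?m}. (det A \<cdot>\<^sub>m 1\<^sub>m ?m) $$ (q, i) * U $ i)"
      unfolding adj(3) using q U by (auto simp: scalar_prod_def intro!: sum.cong)
    also have "\<dots> = (\<Sum>i\<in>{0..<?m}. if i = q then det A * U $ i else 0)"
      using q by (intro sum.cong) auto
    also have "\<dots> = det A * U $ q" using q by simp
    finally show ?thesis .
  qed
  have "h (det A * U $ q) = \<zero>\<^bsub>F\<^esub>" using W0 unfolding Wq .
  then have "h (U $ q) = \<zero>\<^bsub>F\<^esub>" using nz integral[of "h (det A)" "h (U $ q)"] by (simp add: h_mult)
  then show ?thesis using q by (simp add: U_def)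
qed

text \<open>The column \<open>p0\<close> of the adjugate of the window matrix is mapped to \<open>det\<close> times a unit vector.\<close>

lemma message_with_prescribed_zeros:
  assumes m: "m \<le> k * (2 * \<delta> + 1)" "m \<le> k * T" and f: "strict_mono_on {0..<m} f"
    and lo: "\<And>p. p < m \<Longrightarrow> k * (f p div n) \<le> p + \<delta>"
    and hi: "\<And>p. p < m \<Longrightarrow> p < k * (f p div n + 1)"
    and T: "\<And>p. p < m \<Longrightarrow> f p div n < T" and p0: "p0 < m"
  shows "\<exists>u\<in>carrier_vec k.
    (\<forall>q\<ge>m. Polynomial.coeff (u $ (q mod k)) (q div k) = 0) \<and>
    (\<forall>p<m. h (Polynomial.coeff ((gen_mat n k \<delta> *\<^sub>v u) $ (f p mod n)) (f p div n)) = \<zero>\<^bsub>F\<^esub> \<longleftrightarrow> p \<noteq> p0)"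
proof -
  define A where "A = window_matrix n k \<delta> m f"
  have A: "A \<in> carrier_mat m m" by (simp add: A_def window_matrix_def)
  have nz: "h (det A) \<noteq> \<zero>\<^bsub>F\<^esub>" unfolding A_def using m(1) f lo hi by (rule window_det_nonzero)
  note adj = adj_mat[OF A]
  define U where "U = adj_mat A *\<^sub>v unit_vec m p0"
  have U: "U \<in> carrier_vec m" using adj(1) by (simp add: U_def)
  define u where "u = vec k (\<lambda>j. \<Sum>\<tau><T. Polynomial.monom (if k * \<tau> + j < m then U $ (k * \<tau> + j) else 0) \<tau>)"
  have u: "u \<in> carrier_vec k" by (simp add: u_def)
  have cu: "Polynomial.coeff (u $ (q mod k)) (q div k) = (if q < m then U $ q else 0)" for q
  proof -
    have "q mod k < k" using k_pos by simp
    moreover have "q div k < T" if "q < m"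
      using that m(2) by (simp add: less_mult_imp_div_less mult.commute)
    ultimately show ?thesis by (auto simp: u_def Polynomial.coeff_sum)
  qed
  have UU: "vec m (\<lambda>q. Polynomial.coeff (u $ (q mod k)) (q div k)) = U"
    using U by (intro eq_vecI) (auto simp: cu)
  have AU: "A *\<^sub>v U = (A * adj_mat A) *\<^sub>v unit_vec m p0"
    unfolding U_def using assoc_mult_mat_vec[OF A adj(1), of "unit_vec m p0"] by simp
  have "h (Polynomial.coeff ((gen_mat n k \<delta> *\<^sub>v u) $ (f p mod n)) (f p div n)) = \<zero>\<^bsub>F\<^esub> \<longleftrightarrow> p \<noteq> p0" if p: "p < m" for p
  proof -
    have "Polynomial.coeff ((gen_mat n k \<delta> *\<^sub>v u) $ (f p mod n)) (f p div n) = (A *\<^sub>v U) $ p"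
      using window_matrix_mult[where f = f, OF k_pos k_less u p T[OF p] m(2)] cu unfolding UU A_def by simp
    also have "\<dots> = (if p = p0 then det A else 0)"
      unfolding AU adj(2) using p p0 by simp
    finally show ?thesis using nz by (simp add: h_zero)
  qed
  then show ?thesis using u cu by (intro bexI[of _ u]) auto
qed

end

section \<open>Column distances\<close>

context generic_evaluation
begin

definition coeff_hom :: "int poly poly \<Rightarrow> nat \<Rightarrow> 'a" where
  "coeff_hom f i = h (Polynomial.coeff f i)"

definition code :: "(nat \<Rightarrow> 'a) vec set" where
  "code = column_module coeff_hom (gen_mat n k \<delta>)"

lemma coeff_hom_onto: "onto_ring_hom (UP F) coeff_hom"
  using lift_poly unfolding coeff_hom_def[abs_def] .

lemma code_nkd: "nkd_code F n k \<delta> code"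
proof -
  interpret U: onto_ring_hom "UP F" coeff_hom by (rule coeff_hom_onto)
  let ?G = "gen_mat n k \<delta>" and ?\<beta> = "det (bezout_matrix n k \<delta>)"
  obtain X where X: "X \<in> carrier_mat k n" "X * ?G = [:?\<beta>:] \<cdot>\<^sub>m 1\<^sub>m k"
    using gen_mat_left_inverse[OF k_pos k_less] by blast
  obtain w where w: "h (w * ?\<beta>) = \<one>\<^bsub>F\<^esub>"
  proof -
    have "h ?\<beta> \<in> Units F" using bezout_det_nonzero by (simp add: field_Units)
    then obtain y where "y \<in> carrier F" "y \<otimes>\<^bsub>F\<^esub> h ?\<beta> = \<one>\<^bsub>F\<^esub>" by (auto simp: Units_def)
    then show ?thesis using that carrier_eq by (auto simp: h_mult)
  qed
  let ?X = "[:w:] \<cdot>\<^sub>m X"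
  have X': "?X \<in> carrier_mat k n" using X by simp
  have "?X * ?G = [:w:] \<cdot>\<^sub>m (X * ?G)" using X(1) by (intro mult_smult_assoc_mat) auto
  also have "\<dots> = [:w * ?\<beta>:] \<cdot>\<^sub>m 1\<^sub>m k" unfolding X(2) by (intro eq_matI) auto
  finally have XG: "map_mat coeff_hom (?X * ?G) = map_mat coeff_hom (1\<^sub>m k)"
  proof -
    assume eq: "?X * ?G = [:w * ?\<beta>:] \<cdot>\<^sub>m 1\<^sub>m k"
    have "coeff_hom [:w * ?\<beta>:] = coeff_hom 1"
      by (auto simp: coeff_hom_def coeff_pCons w h_zero h_one coeff_1 split: nat.splits)
    then show ?thesis unfolding eq by (intro eq_matI) auto
  qed
  note code = column_module_code[of F h ?G n k ?X, folded coeff_hom_def[abs_def], folded code_def,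
      OF onto_ring_hom_axioms field_axioms gen_mat_carrier(1) X' XG]
  have "code_degree F n k code = \<delta>"
  proof (rule code(2))
    show "degree (det (submatrix ?G I UNIV)) \<le> \<delta>" if "I \<subseteq> {..<n}" "card I = k" for I
      using degree_minor_gen_mat[OF k_pos that] .
    show "{..<k} \<subseteq> {..<n}" using k_less by auto
    show "card {..<k} = k" by simp
    show "h (Polynomial.coeff (det (submatrix ?G {..<k} UNIV)) \<delta>) \<noteq> \<zero>\<^bsub>F\<^esub>"
      using leading_det_nonzero coeff_leading_minor[OF k_pos k_less] by simp
  qed
  then show ?thesis using code(1) by (simp add: nkd_code_def)
qed

definition symbol :: "int poly poly vec \<Rightarrow> nat \<Rightarrow> 'a" where
  "symbol u R = h (Polynomial.coeff ((gen_mat n k \<delta> *\<^sub>v u) $ (R mod n)) (R div n))"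

definition codeword :: "int poly poly vec \<Rightarrow> (nat \<Rightarrow> 'a) vec" where
  "codeword u = map_vec coeff_hom (gen_mat n k \<delta> *\<^sub>v u)"

lemma code_eq: "code = codeword ` carrier_vec k"
  unfolding code_def column_module_def codeword_def by auto

lemma vec_coeff_codeword:
  assumes "i < n"
  shows "vec_coeff F (codeword u) t $ i = symbol u (n * t + i)"
    and "dim_vec (vec_coeff F (codeword u) t) = n"
proof -
  interpret U: onto_ring_hom "UP F" coeff_hom by (rule coeff_hom_onto)
  have "up_ring.coeff (UP F) (coeff_hom f) t = coeff_hom f t" for f
    using U.h_closed[of f] by (simp add: UP_def)
  then show "vec_coeff F (codeword u) t $ i = symbol u (n * t + i)"
    using assms by (simp add: vec_coeff_def codeword_def symbol_def coeff_hom_def del: index_mult_mat_vec)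
  show "dim_vec (vec_coeff F (codeword u) t) = n" by (simp add: vec_coeff_def codeword_def)
qed

lemma weight_window:
  "(\<Sum>t = 0..J. weight F (vec_coeff F (codeword u) t)) = card {R. R < n * (J + 1) \<and> symbol u R \<noteq> \<zero>\<^bsub>F\<^esub>}"
proof -
  have n: "0 < n" using k_less by simp
  have card: "card {i. i < m \<and> P i} = (\<Sum>i<m. if P i then 1 else (0::nat))" for m :: nat and P
  proof -
    have "{i. i < m \<and> P i} = {..<m} \<inter> {i. P i}" by auto
    then show ?thesis by (simp add: sum.If_cases)
  qed
  have "weight F (vec_coeff F (codeword u) t) = (\<Sum>i<n. if symbol u (n * t + i) \<noteq> \<zero>\<^bsub>F\<^esub> then 1 else (0::nat))" for t
  proof -
    have "{i. i < n \<and> vec_coeff F (codeword u) t $ i \<noteq> \<zero>\<^bsub>F\<^esub>} = {i. i < n \<and> symbol u (n * t + i) \<noteq> \<zero>\<^bsub>F\<^esub>}"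
      by (auto simp: vec_coeff_codeword)
    then show ?thesis unfolding weight_def vec_coeff_codeword(2)[OF n] by (simp add: card)
  qed
  then have "(\<Sum>t = 0..J. weight F (vec_coeff F (codeword u) t)) =
      (\<Sum>t<J + 1. \<Sum>i<n. if symbol u (n * t + i) \<noteq> \<zero>\<^bsub>F\<^esub> then 1 else (0::nat))"
    by (intro sum.cong) auto
  also have "\<dots> = (\<Sum>R<n * (J + 1). if symbol u R \<noteq> \<zero>\<^bsub>F\<^esub> then 1 else (0::nat))"
    using sum_div_mod[of "\<lambda>t i. if symbol u (n * t + i) \<noteq> \<zero>\<^bsub>F\<^esub> then 1 else (0::nat)" n "J + 1"] by simp
  finally show ?thesis by (simp add: card)
qed

lemma weight_window_zeros:
  "(\<Sum>t = 0..J. weight F (vec_coeff F (codeword u) t)) + card {R. R < n * (J + 1) \<and> symbol u R = \<zero>\<^bsub>F\<^esub>} = n * (J + 1)"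
proof -
  let ?A = "{R. R < n * (J + 1) \<and> symbol u R \<noteq> \<zero>\<^bsub>F\<^esub>}" and ?B = "{R. R < n * (J + 1) \<and> symbol u R = \<zero>\<^bsub>F\<^esub>}"
  have "?A \<union> ?B = {..<n * (J + 1)}" by auto
  moreover have "card (?A \<union> ?B) = card ?A + card ?B" by (intro card_Un_disjoint) auto
  ultimately show ?thesis by (simp add: weight_window)
qed

lemma initial_symbol_nonzero_iff:
  "vec_coeff F (codeword u) 0 \<noteq> \<zero>\<^bsub>free_module F n\<^esub> \<longleftrightarrow> (\<exists>i<n. symbol u i \<noteq> \<zero>\<^bsub>F\<^esub>)"
proof -
  have "0 < n" using k_less by simp
  then show ?thesis
    using vec_coeff_codeword(1)[of _ u 0] vec_coeff_codeword(2)[of 0 u 0]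
    by (auto simp: free_module_def vec_eq_iff)
qed

text \<open>Otherwise the codeword has at least \<open>k * (J + 1) + x\<close> zeros up to the time \<open>J\<close>, and the message is zero on an initial window;
but then the initial vector of the codeword is zero.\<close>

lemma weight_lower_bound:
  assumes J: "J \<le> 2 * \<delta>" "(n - k) * J \<le> (n - k) * (\<delta> div k) + \<delta> + x" and x: "x \<le> n - k"
    and u: "u \<in> carrier_vec k" and nz: "vec_coeff F (codeword u) 0 \<noteq> \<zero>\<^bsub>free_module F n\<^esub>"
  shows "(n - k) * (J + 1) + 1 \<le> (\<Sum>t = 0..J. weight F (vec_coeff F (codeword u) t)) + x"
proof (rule ccontr)
  assume less: "\<not> ?thesis"
  define Z where "Z = {R. R < n * (J + 1) \<and> symbol u R = \<zero>\<^bsub>F\<^esub>}"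
  have "(n - k) * (J + 1) + k * (J + 1) = n * (J + 1)" using k_less by (simp flip: add_mult_distrib)
  then have card: "k * (J + 1) + x \<le> card Z" using less weight_window_zeros[of u J] unfolding Z_def by linarith
  have "Z \<subseteq> {..<n * (J + 1)}" by (auto simp: Z_def)
  then obtain J' where J': "J' \<le> J" "strict_mono_on {0..<k * (J' + 1)} (pick Z)"
    and sel: "\<And>p. p < k * (J' + 1) \<Longrightarrow> pick Z p \<in> Z" "\<And>p. p < k * (J' + 1) \<Longrightarrow> pick Z p div n < J' + 1"
      "\<And>p. p < k * (J' + 1) \<Longrightarrow> k * (pick Z p div n) \<le> p + \<delta>" "\<And>p. p < k * (J' + 1) \<Longrightarrow> p < k * (pick Z p div n + 1)"
    using select_rows[OF k_pos k_less _ card J(2) x] by (metis less_Suc_eq_le Suc_eq_plus1)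
  have m: "k * (J' + 1) \<le> k * (2 * \<delta> + 1)" using J' J(1) by (intro mult_le_mono2) simp
  have zero: "h (Polynomial.coeff ((gen_mat n k \<delta> *\<^sub>v u) $ (pick Z p mod n)) (pick Z p div n)) = \<zero>\<^bsub>F\<^esub>"
    if "p < k * (J' + 1)" for p
    using sel(1)[OF that] by (simp add: Z_def symbol_def)
  have u0: "h (Polynomial.coeff (u $ j) 0) = \<zero>\<^bsub>F\<^esub>" if "j < k" for j
    using window_zero[OF m J'(2) sel(3,4,2) u zero, of j] that by simp
  have "symbol u i = \<zero>\<^bsub>F\<^esub>" if "i < n" for i
  proof -
    have "Polynomial.coeff ((gen_mat n k \<delta> *\<^sub>v u) $ i) 0 =
      (\<Sum>q<k * 1. if q div k \<le> 0 then gen_coeff n k \<delta> (0 - q div k) i (q mod k) * Polynomial.coeff (u $ (q mod k)) (q div k) else 0)"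
      by (rule coeff_gen_mat_mult[OF k_pos u that]) simp
    also have "\<dots> = (\<Sum>q<k. gen_coeff n k \<delta> 0 i q * Polynomial.coeff (u $ q) 0)"
      by (intro sum.cong) auto
    finally have "symbol u i = (\<Oplus>\<^bsub>F\<^esub>q\<in>{..<k}. h (gen_coeff n k \<delta> 0 i q * Polynomial.coeff (u $ q) 0))"
      using that by (simp add: symbol_def h_sum)
    also have "\<dots> = (\<Oplus>\<^bsub>F\<^esub>q\<in>{..<k}. \<zero>\<^bsub>F\<^esub>)"
      using u0 by (intro finsum_cong') (auto simp: h_mult)
    finally show ?thesis by simp
  qed
  then show False using nz initial_symbol_nonzero_iff by blast
qed

lemma column_distance_eqI:
  assumes "u \<in> carrier_vec k" "vec_coeff F (codeword u) 0 \<noteq> \<zero>\<^bsub>free_module F n\<^esub>"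
    and "(\<Sum>t = 0..J. weight F (vec_coeff F (codeword u) t)) \<le> D"
    and lower: "\<And>u. u \<in> carrier_vec k \<Longrightarrow> vec_coeff F (codeword u) 0 \<noteq> \<zero>\<^bsub>free_module F n\<^esub> \<Longrightarrow>
      D \<le> (\<Sum>t = 0..J. weight F (vec_coeff F (codeword u) t))"
  shows "column_distance F n code J = D"
  unfolding column_distance_def
proof (rule cInf_eq_minimum)
  have "(\<Sum>t = 0..J. weight F (vec_coeff F (codeword u) t)) = D"
    using assms(3) lower[OF assms(1,2)] by simp
  then show "D \<in> {\<Sum>t = 0..J. weight F (vec_coeff F v t) | v. v \<in> code \<and> vec_coeff F v 0 \<noteq> \<zero>\<^bsub>free_module F n\<^esub>}"
    using assms(1,2) unfolding code_eq by blast
  fix w assume "w \<in> {\<Sum>t = 0..J. weight F (vec_coeff F v t) | v. v \<in> code \<and> vec_coeff F v 0 \<noteq> \<zero>\<^bsub>free_module F n\<^esub>}"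
  then show "D \<le> w" using lower unfolding code_eq by auto
qed

lemma weight_upper_bound:
  assumes "Z \<subseteq> {..<n * (J + 1)}" "\<And>R. R \<in> Z \<Longrightarrow> symbol u R = \<zero>\<^bsub>F\<^esub>"
  shows "(\<Sum>t = 0..J. weight F (vec_coeff F (codeword u) t)) + card Z \<le> n * (J + 1)"
proof -
  have "card Z \<le> card {R. R < n * (J + 1) \<and> symbol u R = \<zero>\<^bsub>F\<^esub>}"
    using assms by (intro card_mono) auto
  then show ?thesis using weight_window_zeros[of u J] by linarith
qed

text \<open>The distance is attained by making the first \<open>k\<close> symbols of each block vanish, except for one symbol
of the initial block.\<close>

lemma column_distance_MDP:
  "column_distance F n code (MDP_index n k \<delta>) = (n - k) * (MDP_index n k \<delta> + 1) + 1"
proof -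
  define L where "L = MDP_index n k \<delta>"
  define m where "m = k * (L + 1)"
  define f where "f p = n * (p div k) + p mod k" for p
  have r: "0 < n - k" and n: "0 < n" using k_less by auto
  have kn: "p mod k < n" "p mod k < k" for p using k_pos k_less mod_less_divisor[of k p] by linarith+
  have f: "f p div n = p div k" "f p mod n = p mod k" for p
    using kn[of p] n by (simp_all add: f_def)
  have L: "L \<le> 2 * \<delta>"
    using div_le_dividend[of \<delta> k] div_le_dividend[of \<delta> "n - k"] unfolding L_def MDP_index_def by linarith
  have fm: "strict_mono_on {0..<m} f"
    unfolding f_def by (intro strict_mono_onI mixed_radix_strict_mono) (use k_pos k_less in auto)
  have lo: "k * (f p div n) \<le> p + \<delta>" for p unfolding f by (simp add: trans_le_add1)
  have hi: "p < k * (f p div n + 1)" for p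
    unfolding f using kn(2)[of p] mult_div_mod_eq[of k p] unfolding distrib_left by linarith
  have fT: "f p div n < L + 1" if "p < m" for p
    unfolding f using that by (simp add: m_def less_mult_imp_div_less mult.commute)
  have p0: "k - 1 < m" using k_pos unfolding m_def by simp
  have "m \<le> k * (2 * \<delta> + 1)" unfolding m_def using L by (intro mult_le_mono2) simp
  from message_with_prescribed_zeros[OF this _ fm lo hi fT p0]
  obtain u where u: "u \<in> carrier_vec k" and sym: "\<And>p. p < m \<Longrightarrow> symbol u (f p) = \<zero>\<^bsub>F\<^esub> \<longleftrightarrow> p \<noteq> k - 1"
    unfolding symbol_def by (auto simp: m_def)
  show ?thesis
    unfolding L_def[symmetric]
  proof (rule column_distance_eqI[OF u])
    have "symbol u (k - 1) \<noteq> \<zero>\<^bsub>F\<^esub>" using sym[OF p0] k_pos by (simp add: f_def)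
    then show "vec_coeff F (codeword u) 0 \<noteq> \<zero>\<^bsub>free_module F n\<^esub>"
      unfolding initial_symbol_nonzero_iff using k_less by (intro exI[of _ "k - 1"]) simp
    let ?Z = "f ` ({0..<m} - {k - 1})"
    have "(\<Sum>t = 0..L. weight F (vec_coeff F (codeword u) t)) + card ?Z \<le> n * (L + 1)"
    proof (rule weight_upper_bound)
      show "?Z \<subseteq> {..<n * (L + 1)}"
      proof
        fix R assume "R \<in> ?Z"
        then have "R \<in> f ` {0..<m}" by blast
        then obtain p where "p \<in> {0..<m}" "R = f p" by (elim imageE)
        then have p: "R = f p" "p < m" by simp_all
        have "f p div n < L + 1" using fT[OF p(2)] .
        then show "R \<in> {..<n * (L + 1)}" using n by (simp add: p(1) div_less_iff_less_mult mult.commute)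
      qed
      show "symbol u R = \<zero>\<^bsub>F\<^esub>" if "R \<in> ?Z" for R using that sym by auto
    qed
    moreover have "card ?Z = m - 1"
    proof -
      have "inj_on f ({0..<m} - {k - 1})"
        using strict_mono_on_imp_inj_on[OF fm] by (rule inj_on_subset) auto
      then show ?thesis using p0 by (simp add: card_image)
    qed
    moreover have "m + (n - k) * (L + 1) = n * (L + 1)" unfolding m_def using k_less by (simp flip: add_mult_distrib)
    ultimately show "(\<Sum>t = 0..L. weight F (vec_coeff F (codeword u) t)) \<le> (n - k) * (L + 1) + 1"
      using p0 by linarith
  next
    fix u assume "u \<in> carrier_vec k" "vec_coeff F (codeword u) 0 \<noteq> \<zero>\<^bsub>free_module F n\<^esub>"
    moreover have "(n - k) * L \<le> (n - k) * (\<delta> div k) + \<delta> + 0"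
      unfolding L_def MDP_index_def distrib_left by simp
    ultimately show "(n - k) * (L + 1) + 1 \<le> (\<Sum>t = 0..L. weight F (vec_coeff F (codeword u) t))"
      using weight_lower_bound[OF L, of 0 u] by simp
  qed
qed

lemma sMDS_index_bounds:
  assumes "sMDS_index n k \<delta> = \<delta> div k + c"
  shows "\<delta> \<le> (n - k) * c" "(n - k) * c \<le> \<delta> + (n - k)" "c \<le> \<delta>"
proof -
  have r: "0 < n - k" using k_less by simp
  have c: "c = nat \<lceil>real \<delta> / real (n - k)\<rceil>" using assms by (simp add: sMDS_index_def)
  have 1: "real \<delta> / real (n - k) \<le> real c" unfolding c by (rule real_nat_ceiling_ge)
  have "real c = real_of_int \<lceil>real \<delta> / real (n - k)\<rceil>" by (simp add: c)
  then have 2: "real c < real \<delta> / real (n - k) + 1"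
    using ceiling_correct[of "real \<delta> / real (n - k)", THEN conjunct1] by (simp only: diff_less_eq)
  have "real \<delta> \<le> real ((n - k) * c)" using 1 r by (simp add: field_simps)
  then show "\<delta> \<le> (n - k) * c" by linarith
  have "real ((n - k) * c) < real (\<delta> + (n - k))" using 2 r by (simp add: field_simps)
  then have lt: "(n - k) * c < \<delta> + (n - k)" by linarith
  then show "(n - k) * c \<le> \<delta> + (n - k)" by simp
  show "c \<le> \<delta>"
  proof (rule ccontr)
    assume "\<not> c \<le> \<delta>"
    then have "(n - k) * (\<delta> + 1) \<le> (n - k) * c" by (intro mult_le_mono2) simp
    moreover have "1 * \<delta> \<le> (n - k) * \<delta>" using r by (intro mult_le_mono1) linarith
    ultimately show False using lt unfolding distrib_left mult_1 by linarith
  qed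
qed

text \<open>The distance is attained by a constant combination of the \<open>k - b\<close> columns of degree \<open>a\<close> whose
initial vector has \<open>k - b - 1\<close> zeros: all later zeros are caused by its small degree.  The surplus \<open>x\<close> in the lower
bound is the difference of \<open>(n - k) * c\<close> and \<open>\<delta>\<close>, where \<open>c\<close> is the ceiling of \<open>\<delta> / (n - k)\<close>.\<close>

lemma column_distance_sMDS:
  "column_distance F n code (sMDS_index n k \<delta>) = (n - k) * (\<delta> div k + 1) + \<delta> + 1"
proof -
  define M where "M = sMDS_index n k \<delta>"
  define a where "a = \<delta> div k"
  obtain c where M: "M = a + c" using that unfolding M_def sMDS_index_def a_def by blast
  note c = sMDS_index_bounds[OF M[unfolded M_def a_def]]
  obtain x where x: "(n - k) * c = \<delta> + x" using c(1) le_iff_add by blast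
  have r: "0 < n - k" and n: "0 < n" using k_less by auto
  have \<delta>: "\<delta> = k * a + \<delta> mod k" by (simp add: a_def)
  have b: "\<delta> mod k < k" using k_pos by simp
  \<comment> \<open>The number of columns of degree \<open>a\<close>.\<close>
  define m where "m = k - \<delta> mod k"
  have m: "0 < m" "m \<le> k" using b by (auto simp: m_def)
  have id: "p div n = 0" "p mod n = p" if "p < m" for p using that m k_less by auto
  have "m \<le> k * (2 * \<delta> + 1)" using m(2) by (simp add: trans_le_add1)
  moreover have "strict_mono_on {0..<m} (\<lambda>p. p)" by (auto simp: strict_mono_on_def)
  moreover have "m - 1 < m" using m by simp
  ultimately obtain u where u: "u \<in> carrier_vec k"
    and sup: "\<And>q. m \<le> q \<Longrightarrow> Polynomial.coeff (u $ (q mod k)) (q div k) = 0"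
    and sym: "\<And>p. p < m \<Longrightarrow> symbol u p = \<zero>\<^bsub>F\<^esub> \<longleftrightarrow> p \<noteq> m - 1"
    using message_with_prescribed_zeros[of m 1 "\<lambda>p. p" "m - 1"] m id unfolding symbol_def by auto
  have late: "symbol u R = \<zero>\<^bsub>F\<^esub>" if R: "a < R div n" for R
  proof -
    have "R mod n < n" using n by simp
    have "Polynomial.coeff ((gen_mat n k \<delta> *\<^sub>v u) $ (R mod n)) (R div n) =
      (\<Sum>q<k * (R div n + 1). if q div k \<le> R div n
         then gen_coeff n k \<delta> (R div n - q div k) (R mod n) (q mod k) * Polynomial.coeff (u $ (q mod k)) (q div k) else 0)"
      by (rule coeff_gen_mat_mult[OF k_pos u \<open>R mod n < n\<close>]) simp
    also have "\<dots> = 0"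
    proof (intro sum.neutral ballI)
      fix q
      show "(if q div k \<le> R div n
         then gen_coeff n k \<delta> (R div n - q div k) (R mod n) (q mod k) * Polynomial.coeff (u $ (q mod k)) (q div k) else 0) = 0"
      proof (cases "q < m")
        case True
        then have "q div k = 0" "q mod k = q" using m by auto
        moreover have "column_degree k \<delta> q = a" using True by (simp add: column_degree_def m_def a_def)
        ultimately show ?thesis using R by (simp add: gen_coeff_eq_0)
      next
        case False
        then show ?thesis using sup[of q] by simp
      qed
    qed
    finally show ?thesis by (simp add: symbol_def h_zero)
  qed
  show ?thesis
    unfolding M_def[symmetric] a_def[symmetric]
  proof (rule column_distance_eqI[OF u])
    have "symbol u (m - 1) \<noteq> \<zero>\<^bsub>F\<^esub>" using sym[of "m - 1"] m by simp
    then show "vec_coeff F (codeword u) 0 \<noteq> \<zero>\<^bsub>free_module F n\<^esub>"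
      unfolding initial_symbol_nonzero_iff using m k_less by (intro exI[of _ "m - 1"]) simp
    let ?Z = "{..<m - 1} \<union> {n * (a + 1)..<n * (M + 1)}"
    have "(\<Sum>t = 0..M. weight F (vec_coeff F (codeword u) t)) + card ?Z \<le> n * (M + 1)"
    proof (rule weight_upper_bound)
      have "m - 1 \<le> n * (M + 1)" using m k_less by (simp add: trans_le_add1)
      then show "?Z \<subseteq> {..<n * (M + 1)}" by auto
      show "symbol u R = \<zero>\<^bsub>F\<^esub>" if "R \<in> ?Z" for R
        using that
      proof
        assume "R \<in> {..<m - 1}"
        then show ?thesis using sym[of R] by simp
      next
        assume "R \<in> {n * (a + 1)..<n * (M + 1)}"
        then have "a + 1 \<le> R div n" using n by (simp add: less_eq_div_iff_mult_less_eq mult.commute)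
        then show ?thesis by (intro late) simp
      qed
    qed
    moreover have "card ?Z = (m - 1) + (n * (M + 1) - n * (a + 1))"
    proof -
      have "m - 1 \<le> n * (a + 1)" using m k_less by (simp add: trans_le_add1)
      then show ?thesis by (subst card_Un_disjoint) auto
    qed
    moreover have "n * (a + 1) \<le> n * (M + 1)" using M by (intro mult_le_mono2) simp
    moreover have "(n - k) * (a + 1) + k * (a + 1) = n * (a + 1)" using k_less by (simp flip: add_mult_distrib)
    moreover have "k * (a + 1) = k * a + k" by simp
    ultimately show "(\<Sum>t = 0..M. weight F (vec_coeff F (codeword u) t)) \<le> (n - k) * (a + 1) + \<delta> + 1"
      using m b \<delta> unfolding m_def by linarith
  next
    fix u assume u: "u \<in> carrier_vec k" "vec_coeff F (codeword u) 0 \<noteq> \<zero>\<^bsub>free_module F n\<^esub>"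
    have "M \<le> 2 * \<delta>" using c(3) div_le_dividend[of \<delta> k] unfolding M a_def by linarith
    moreover have "(n - k) * M \<le> (n - k) * (\<delta> div k) + \<delta> + x" unfolding M distrib_left x a_def by simp
    moreover have "x \<le> n - k" using c(2) x by simp
    ultimately have "(n - k) * (M + 1) + 1 \<le> (\<Sum>t = 0..M. weight F (vec_coeff F (codeword u) t)) + x"
      using u by (rule weight_lower_bound)
    moreover have "(n - k) * (M + 1) = (n - k) * (a + 1) + \<delta> + x"
      unfolding M by (simp add: distrib_left x)
    ultimately show "(n - k) * (a + 1) + \<delta> + 1 \<le> (\<Sum>t = 0..M. weight F (vec_coeff F (codeword u) t))" by linarith
  qed
qed

end

theorem theorem4p5:
  fixes n k \<delta> p :: nat
  assumes "0 < k" and "k < n" and "prime p"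
  shows "\<exists>(F :: nat ring) C. field F \<and> finite (carrier F) \<and> ring_characteristic F = p \<and>
           MDP_code F n k \<delta> C \<and> sMDS_code F n k \<delta> C"
proof -
  obtain F :: "nat ring" and h where F: "generic_evaluation F h n k \<delta>" "finite (carrier F)" "ring_characteristic F = p"
    using generic_evaluation_exists[OF assms] by blast
  interpret generic_evaluation F h n k \<delta> by (rule F(1))
  have "MDP_code F n k \<delta> code" "sMDS_code F n k \<delta> code"
    by (simp_all add: MDP_code_def sMDS_code_def code_nkd column_distance_MDP column_distance_sMDS)
  then show ?thesis using F field_axioms by blast
qed

end
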